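(* Let $f\in \mathbb{R}[x, y, z]$ be a quadratic polynomial that depends on each of the variables $x,y,z$ and that does not have the form $g(h(x)+k(y)+l(z))$ for any one-variable polynomials $g,h,k,l$. Let $A, B, C\subset \mathbb{R}$ be compact sets with $\dim_H(A)+\dim_H(B)+\dim_H(C)>2$. Then $|f(A, B, C)|>0$.
   Context: $\dim_H(X)$ denotes the Hausdorff dimension of $X$, and $|X|$ denotes the Lebesgue measure of $X\subset\mathbb{R}$. A quadratic polynomial is a polynomial of total degree $2$. The polynomial $f$ depends on each variable if each of $x$, $y$, $z$ genuinely occurs in $f$ (no partial derivative of $f$ is identically zero). The one-variable polynomials $g,h,k,l$ have real coefficients. $f(A,B,C)=\{f(x,y,z): x\in A,\ y\in B,\ z\in C\}$. *)

theory Defs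
  imports "HOL-Analysis.Analysis" "HOL-Library.Poly_Mapping" "HOL-Computational_Algebra.Polynomial"
begin

text \<open>
  The ring R[x,y,z] as the monoid algebra of the exponent monoid: the key (i, j, k) stands for
  the monomial x^i y^j z^k, and
  \<^term>\<open>Poly_Mapping.keys f\<close> is the set of monomials with nonzero coefficient.
\<close>

type_synonym poly3 = "(nat \<times> nat \<times> nat) \<Rightarrow>\<^sub>0 real"

definition eval3 :: "poly3 \<Rightarrow> real \<Rightarrow> real \<Rightarrow> real \<Rightarrow> real" where
  "eval3 f x y z = (\<Sum>(i, j, k)\<in>Poly_Mapping.keys f.
     Poly_Mapping.lookup f (i, j, k) * x ^ i * y ^ j * z ^ k)"

text \<open>The zero polynomial gets total degree 0.\<close>

definition total_degree3 :: "poly3 \<Rightarrow> nat" where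
  "total_degree3 f = Max (insert 0 ((\<lambda>(i, j, k). i + j + k) ` Poly_Mapping.keys f))"

definition depends_on_each_variable :: "poly3 \<Rightarrow> bool" where
  "depends_on_each_variable f \<longleftrightarrow>
     (\<exists>(i, j, k)\<in>Poly_Mapping.keys f. i > 0) \<and>
     (\<exists>(i, j, k)\<in>Poly_Mapping.keys f. j > 0) \<and>
     (\<exists>(i, j, k)\<in>Poly_Mapping.keys f. k > 0)"

definition image3 :: "poly3 \<Rightarrow> real set \<Rightarrow> real set \<Rightarrow> real set \<Rightarrow> real set" where
  "image3 f A B C = {eval3 f x y z | x y z. x \<in> A \<and> y \<in> B \<and> z \<in> C}"

text \<open>
  The term diam(U)^s, with the conventions that the empty set contributes 0 and that
  diam(U)^0 = 1 for nonempty U (whereas \<^term>\<open>0 powr 0 = (0::real)\<close> in the library).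
\<close>

definition diam_pow :: "real \<Rightarrow> 'a::metric_space set \<Rightarrow> ennreal" where
  "diam_pow s U = (if U = {} then 0 else if s = 0 then 1 else ennreal (diameter U powr s))"

text \<open>
  Covers are restricted to bounded sets because \<^const>\<open>diameter\<close> is real-valued and
  meaningless on unbounded sets.  Finite covers are included, as \<^term>\<open>U n\<close> may be empty.
\<close>

definition hausdorff_content :: "real \<Rightarrow> real \<Rightarrow> 'a::metric_space set \<Rightarrow> ennreal" where
  "hausdorff_content s \<delta> X =
     (INF U\<in>{U :: nat \<Rightarrow> 'a set. X \<subseteq> (\<Union>n. U n) \<and> (\<forall>n. bounded (U n) \<and> diameter (U n) \<le> \<delta>)}.
        suminf (\<lambda>n. diam_pow s (U n)))"

definition hausdorff_measure :: "real \<Rightarrow> 'a::metric_space set \<Rightarrow> ennreal" where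
  "hausdorff_measure s X = (SUP \<delta>\<in>{0<..}. hausdorff_content s \<delta> X)"

definition hausdorff_dim :: "'a::metric_space set \<Rightarrow> ennreal" where
  "hausdorff_dim X = (INF s\<in>{s. 0 \<le> s \<and> hausdorff_measure s X = 0}. ennreal s)"

end

theory Submission
  imports Defs "HOL-Probability.Characteristic_Functions"
begin

text \<open>
  Singling out one variable, say \<open>x\<close>, the polynomial has the form
  \<open>r x + x * v + w\<close> with \<open>v = a * y + b * z\<close> linear and \<open>w\<close> quadratic in \<open>(y, z)\<close>.
  Where the affine Jacobian \<open>a * w_z - b * w_y\<close> is bounded away from zero, the map
  \<open>(y, z) \<mapsto> (v, w)\<close> is expanding (the midpoint rule is exact for quadratics), so it carries the product
  of Frostman weights on \<open>B\<close> and \<open>C\<close> to a planar weight of exponent \<open>\<beta> + \<gamma>\<close>, and the claim becomes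
  Falconer's theorem on the projections \<open>x * v + w\<close>, valid since \<open>\<alpha> + (\<beta> + \<gamma>) > 2\<close>. If the Jacobians for all three choices
  of the singled-out variable vanish identically, the polynomial is a quadratic function of one linear form.

  Falconer's theorem is proved for finitely supported weights at scale \<open>2 ^ - N\<close> with constants independent of \<open>N\<close>,
  so that no limit measure is needed. The energy \<open>E R\<close> of the projections, smoothed at
  scale \<open>1 / R\<close>, is a Gaussian average of the squared Fourier transform over the lines of slopes \<open>x\<close>. Passing from
  \<open>R / 2\<close> to \<open>R\<close> only involves frequencies of size about \<open>R\<close>, where the transform is essentially constant at scale \<open>1 / R\<close> in \<open>x\<close>; thus
  the weight on \<open>x\<close> may be replaced by a density at most \<open>R powr (1 - \<alpha>)\<close>, which in polar coordinates turns the increment of \<open>R * E R\<close>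
  into a planar energy of size \<open>R powr (2 - \<alpha> - \<beta> - \<gamma>)\<close>, summable over dyadic \<open>R\<close>.
\<close>

section \<open>Gaussian integrals and sums\<close>

text \<open>The real part of the characteristic function of the standard normal distribution,
  multiplied by the phase \<open>iexp \<theta>\<close>; the factor \<open>sqrt (2 * pi)\<close>
  undoes the normalisation of the density.\<close>

lemma has_integral_cos_std_gaussian:
  "has_bochner_integral lborel (\<lambda>y. cos (y * D + \<theta>) * exp (- y\<^sup>2 / 2))
     (sqrt (2 * pi) * exp (- D\<^sup>2 / 2) * cos \<theta>)"
proof -
  let ?c = "sqrt (2 * pi)"
  have c: "?c \<noteq> 0" by simp
  have int: "integrable lborel (\<lambda>x. std_normal_density x *\<^sub>R iexp (D * x + \<theta>))"
  proof (rule Bochner_Integration.integrable_bound[OF integrable_normal_density[of 1 0]])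
    show "AE x in lborel. norm (std_normal_density x *\<^sub>R iexp (D * x + \<theta>))
        \<le> norm (std_normal_density x)"
      by simp
  qed simp_all
  have "(LINT x|lborel. std_normal_density x *\<^sub>R iexp (D * x)) = char std_normal_distribution D"
    unfolding char_def by (subst integral_density) auto
  also have "\<dots> = complex_of_real (exp (- D\<^sup>2 / 2))"
    by (simp add: char_std_normal_distribution)
  finally have "(LINT x|lborel. iexp \<theta> * (std_normal_density x *\<^sub>R iexp (D * x)))
      = iexp \<theta> * complex_of_real (exp (- D\<^sup>2 / 2))"
    by (simp only: integral_mult_right_zero)
  moreover have "iexp \<theta> * (std_normal_density x *\<^sub>R iexp (D * x))
      = std_normal_density x *\<^sub>R iexp (D * x + \<theta>)" for x
    by (simp add: exp_add distrib_left mult.commute)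
  ultimately have "(LINT x|lborel. std_normal_density x *\<^sub>R iexp (D * x + \<theta>))
      = iexp \<theta> * complex_of_real (exp (- D\<^sup>2 / 2))"
    by (simp only:)
  with int have "has_bochner_integral lborel (\<lambda>x. std_normal_density x *\<^sub>R iexp (D * x + \<theta>))
      (iexp \<theta> * complex_of_real (exp (- D\<^sup>2 / 2)))"
    by (simp add: has_bochner_integral_iff)
  from has_bochner_integral_Re[OF this]
  have "has_bochner_integral lborel (\<lambda>x. std_normal_density x * cos (D * x + \<theta>))
      (exp (- D\<^sup>2 / 2) * cos \<theta>)"
    by (simp add: Re_exp mult.commute)
  from has_bochner_integral_mult_right[OF this, of ?c]
  have "has_bochner_integral lborel (\<lambda>x. ?c * (std_normal_density x * cos (D * x + \<theta>)))
      (?c * (exp (- D\<^sup>2 / 2) * cos \<theta>))"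
    using c by simp
  moreover have "?c * (std_normal_density x * cos (D * x + \<theta>)) = cos (x * D + \<theta>) * exp (- x\<^sup>2 / 2)" for x
    using c by (simp add: std_normal_density_def mult.commute)
  ultimately show ?thesis by (simp only: mult.assoc)
qed

text \<open>All Fourier analysis below reduces to this integral: finite cosine sums are integrated
  term by term against Gaussians of mean \<open>t\<close> and deviation
  \<open>\<kappa>\<close>.\<close>

lemma has_integral_cos_gaussian:
  assumes "\<kappa> > 0"
  shows "has_bochner_integral lborel (\<lambda>y. cos (y * D + \<theta>) * exp (- (y - t)\<^sup>2 / (2 * \<kappa>\<^sup>2)))
     (\<kappa> * sqrt (2 * pi) * exp (- (\<kappa> * D)\<^sup>2 / 2) * cos (t * D + \<theta>))"
proof -
  have *: "cos ((t + \<kappa> * y) * D + \<theta>) * exp (- ((t + \<kappa> * y) - t)\<^sup>2 / (2 * \<kappa>\<^sup>2))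
      = cos (y * (\<kappa> * D) + (t * D + \<theta>)) * exp (- y\<^sup>2 / 2)" for y
  proof -
    have "(t + \<kappa> * y) * D + \<theta> = y * (\<kappa> * D) + (t * D + \<theta>)" by algebra
    moreover have "- ((t + \<kappa> * y) - t)\<^sup>2 / (2 * \<kappa>\<^sup>2) = - y\<^sup>2 / 2"
      using assms by (simp add: power_mult_distrib)
    ultimately show ?thesis by (simp only:)
  qed
  have **: "(\<kappa> * sqrt (2 * pi) * exp (- (\<kappa> * D)\<^sup>2 / 2) * cos (t * D + \<theta>)) /\<^sub>R \<bar>\<kappa>\<bar>
      = sqrt (2 * pi) * exp (- (\<kappa> * D)\<^sup>2 / 2) * cos (t * D + \<theta>)"
    using assms by (simp add: field_simps)
  show ?thesis
    using assms has_integral_cos_std_gaussian[of "\<kappa> * D" "t * D + \<theta>"]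
    by (subst lborel_has_bochner_integral_real_affine_iff[where c=\<kappa> and t=t])
       (simp, simp only: * **)
qed

text \<open>A Gaussian is dominated by a geometric sequence in the index of the unit cell of
  \<open>z\<close>, which makes sums over cells elementary. Expanding the square of
  \<open>\<bar>z\<bar>/2 - ln 2\<close> gives the decay; bounding \<open>(ln 2)\<^sup>2\<close> by
  \<open>ln 2\<close> costs one factor 2 and passing to the floor another.\<close>

lemma gaussian_le_powr2_floor: "exp (- z\<^sup>2 / 4) \<le> 4 * (1/2) powr \<bar>real_of_int \<lfloor>z\<rfloor>\<bar>"
proof -
  have fl: "\<bar>real_of_int \<lfloor>z\<rfloor>\<bar> \<le> \<bar>z\<bar> + 1" by linarith
  have "0 \<le> (\<bar>z\<bar>/2 - ln 2)\<^sup>2" by simp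
  then have "- z\<^sup>2 / 4 \<le> (ln 2)\<^sup>2 - \<bar>z\<bar> * ln 2"
    by (simp add: power2_diff power_divide)
  also have "(ln 2)\<^sup>2 \<le> ln (2::real)"
    using ln_2_less_1 by (simp add: power2_eq_square)
  finally have "- z\<^sup>2 / 4 \<le> (1 - \<bar>z\<bar>) * ln 2" by (simp add: algebra_simps)
  also have "\<dots> \<le> (2 - \<bar>real_of_int \<lfloor>z\<rfloor>\<bar>) * ln 2"
    using fl by (intro mult_right_mono) auto
  finally have "exp (- z\<^sup>2 / 4) \<le> exp ((2 - \<bar>real_of_int \<lfloor>z\<rfloor>\<bar>) * ln 2)" by simp
  also have "\<dots> = 2 powr (2 - \<bar>real_of_int \<lfloor>z\<rfloor>\<bar>)" by (simp add: powr_def)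
  also have "\<dots> = 4 * (1/2) powr \<bar>real_of_int \<lfloor>z\<rfloor>\<bar>"
    by (simp add: powr_diff powr_divide)
  finally show ?thesis .
qed

lemma sum_half_powr_abs_le:
  assumes "finite (P :: int set)"
  shows "(\<Sum>p\<in>P. (1/2) powr \<bar>real_of_int p\<bar>) \<le> (4::real)"
proof -
  define n where "n = nat (Max (insert 0 ((\<lambda>p. \<bar>p\<bar>) ` P)))"
  \<comment> \<open>The index 0 lies in both images; counting it twice is harmless and gives the
    bound 2 + 2.\<close>
  have sub: "P \<subseteq> int ` {..n} \<union> (\<lambda>k. - int k) ` {..n}"
  proof
    fix p assume "p \<in> P"
    then have "\<bar>p\<bar> \<le> Max (insert 0 ((\<lambda>p. \<bar>p\<bar>) ` P))"
      using assms by (intro Max_ge) auto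
    then have "nat \<bar>p\<bar> \<le> n" unfolding n_def by linarith
    moreover have "p = int (nat \<bar>p\<bar>) \<or> p = - int (nat \<bar>p\<bar>)" by linarith
    ultimately show "p \<in> int ` {..n} \<union> (\<lambda>k. - int k) ` {..n}" by blast
  qed
  let ?g = "\<lambda>p::int. (1/2) powr \<bar>real_of_int p\<bar> :: real"
  have "(\<Sum>k\<le>n. (1/2::real)^k) = 2 - (1/2)^n"
    by (induction n) auto
  then have geo: "(\<Sum>k\<le>n. (1/2::real)^k) \<le> 2" by simp
  have "sum ?g P \<le> sum ?g (int ` {..n} \<union> (\<lambda>k. - int k) ` {..n})"
    by (rule sum_mono2[OF _ sub]) auto
  also have "\<dots> \<le> sum ?g (int ` {..n}) + sum ?g ((\<lambda>k. - int k) ` {..n})"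
    by (subst sum_Un) (auto intro!: sum_nonneg)
  also have "\<dots> \<le> 2 + 2"
  proof (rule add_mono)
    show "sum ?g (int ` {..n}) \<le> 2"
      using geo by (subst sum.reindex) (auto simp: inj_on_def powr_realpow)
    show "sum ?g ((\<lambda>k. - int k) ` {..n}) \<le> 2"
      using geo by (subst sum.reindex) (auto simp: inj_on_def powr_realpow)
  qed
  finally show ?thesis by simp
qed

text \<open>The points are grouped by unit cells of \<open>(z k, z' k)\<close>. Each cell has mass
  at most \<open>M\<close>, and the Gaussian factors are summable over cells: \<open>4 * 4\<close>
  comes from the pointwise bound and \<open>4 * 4\<close> from the two geometric sums.\<close>

lemma gaussian_sum_le_cells:
  fixes m z z' :: "'k \<Rightarrow> real"
  assumes fin: "finite K" and m: "\<And>k. k \<in> K \<Longrightarrow> 0 \<le> m k"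
    and cell: "\<And>p q. (\<Sum>k | k \<in> K \<and> \<lfloor>z k\<rfloor> = p \<and> \<lfloor>z' k\<rfloor> = q. m k) \<le> M"
  shows "(\<Sum>k\<in>K. m k * (exp (- (z k)\<^sup>2 / 4) * exp (- (z' k)\<^sup>2 / 4))) \<le> 256 * M"
proof -
  let ?P = "(\<lambda>k. \<lfloor>z k\<rfloor>) ` K" and ?Q = "(\<lambda>k. \<lfloor>z' k\<rfloor>) ` K"
  let ?h = "\<lambda>p::int. (1/2) powr \<bar>real_of_int p\<bar> :: real"
  have M: "0 \<le> M"
    by (rule order_trans[OF sum_nonneg cell[of 0 0]]) (use m in auto)
  have "(\<Sum>k\<in>K. m k * (exp (- (z k)\<^sup>2 / 4) * exp (- (z' k)\<^sup>2 / 4)))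
      \<le> (\<Sum>k\<in>K. m k * (16 * (?h \<lfloor>z k\<rfloor> * ?h \<lfloor>z' k\<rfloor>)))"
  proof (intro sum_mono mult_left_mono m)
    fix k
    have "exp (- (z k)\<^sup>2 / 4) * exp (- (z' k)\<^sup>2 / 4) \<le> (4 * ?h \<lfloor>z k\<rfloor>) * (4 * ?h \<lfloor>z' k\<rfloor>)"
      by (intro mult_mono gaussian_le_powr2_floor) auto
    then show "exp (- (z k)\<^sup>2 / 4) * exp (- (z' k)\<^sup>2 / 4) \<le> 16 * (?h \<lfloor>z k\<rfloor> * ?h \<lfloor>z' k\<rfloor>)"
      by simp
  qed
  also have "\<dots> = (\<Sum>c\<in>?P \<times> ?Q. \<Sum>k | k \<in> K \<and> (\<lfloor>z k\<rfloor>, \<lfloor>z' k\<rfloor>) = c.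
      m k * (16 * (?h \<lfloor>z k\<rfloor> * ?h \<lfloor>z' k\<rfloor>)))"
    by (rule sum.group[symmetric]) (use fin in auto)
  also have "\<dots> = (\<Sum>(p, q)\<in>?P \<times> ?Q. (16 * (?h p * ?h q)) *
      (\<Sum>k | k \<in> K \<and> \<lfloor>z k\<rfloor> = p \<and> \<lfloor>z' k\<rfloor> = q. m k))"
  proof (intro sum.cong refl, clarify)
    fix p q
    show "(\<Sum>k | k \<in> K \<and> (\<lfloor>z k\<rfloor>, \<lfloor>z' k\<rfloor>) = (p, q). m k * (16 * (?h \<lfloor>z k\<rfloor> * ?h \<lfloor>z' k\<rfloor>)))
      = (16 * (?h p * ?h q)) * (\<Sum>k | k \<in> K \<and> \<lfloor>z k\<rfloor> = p \<and> \<lfloor>z' k\<rfloor> = q. m k)"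
      unfolding sum_distrib_left by (rule sum.cong) auto
  qed
  also have "\<dots> \<le> (\<Sum>(p, q)\<in>?P \<times> ?Q. (16 * (?h p * ?h q)) * M)"
    by (rule sum_mono, clarify, rule mult_left_mono[OF cell]) simp
  also have "\<dots> = 16 * M * (sum ?h ?P * sum ?h ?Q)"
  proof -
    have "sum ?h ?P * sum ?h ?Q = (\<Sum>(p, q)\<in>?P \<times> ?Q. ?h p * ?h q)"
      by (simp only: sum_product sum.cartesian_product)
    then show ?thesis
      by (simp only: sum_distrib_left) (rule sum.cong, auto)
  qed
  also have "\<dots> \<le> 16 * M * (4 * 4)"
    using M by (intro mult_left_mono mult_mono sum_half_powr_abs_le finite_imageI fin sum_nonneg) simp_all
  finally show ?thesis by simp
qed

section \<open>Trigonometric forms and their Gaussian averages\<close>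

text \<open>The power series of \<open>exp\<close> splits the kernel into rank-one kernels
  \<open>v k ^ n * v l ^ n / fact n\<close>, each of which contributes a nonnegative square; the
  left side is the term \<open>n = 0\<close>.\<close>

lemma sum_sq_le_exp_form:
  fixes p v :: "'k \<Rightarrow> real"
  assumes "finite K"
  shows "(\<Sum>k\<in>K. p k)\<^sup>2 \<le> (\<Sum>k\<in>K. \<Sum>l\<in>K. p k * p l * exp (v k * v l))"
proof -
  define t where "t n = (\<Sum>k\<in>K. \<Sum>l\<in>K. p k * p l * ((v k * v l) ^ n /\<^sub>R fact n))" for n
  have sums: "t sums (\<Sum>k\<in>K. \<Sum>l\<in>K. p k * p l * exp (v k * v l))"
    unfolding t_def by (intro sums_sum sums_mult exp_converges)
  have t: "t n = (\<Sum>k\<in>K. p k * v k ^ n)\<^sup>2 / fact n" for n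
    unfolding t_def power2_eq_square sum_product sum_divide_distrib
    by (intro sum.cong refl) (simp add: power_mult_distrib divide_inverse mult_ac)
  have "sum t {0} \<le> suminf t"
    by (rule sum_le_suminf) (use sums in \<open>auto simp: t sums_iff\<close>)
  then show ?thesis
    using sums by (simp add: t sums_iff)
qed

text \<open>The squared modulus, at frequency \<open>(\<eta>, \<xi>)\<close>, of the Fourier
  transform of the measure with mass \<open>m k\<close> at \<open>(v k, w k)\<close>, written so
  that everything stays real.\<close>

definition trig_form :: "'k set \<Rightarrow> ('k \<Rightarrow> real) \<Rightarrow> ('k \<Rightarrow> real) \<Rightarrow> ('k \<Rightarrow> real) \<Rightarrow> real \<Rightarrow> real \<Rightarrow> real" where
  "trig_form K m v w \<eta> \<xi> =
     (\<Sum>k\<in>K. \<Sum>l\<in>K. m k * m l * cos (\<eta> * (v k - v l) + \<xi> * (w k - w l)))"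

lemma trig_form_eq_squares:
  "trig_form K m v w \<eta> \<xi> =
     (\<Sum>k\<in>K. m k * cos (\<eta> * v k + \<xi> * w k))\<^sup>2 + (\<Sum>k\<in>K. m k * sin (\<eta> * v k + \<xi> * w k))\<^sup>2"
proof -
  have "cos (\<eta> * (v k - v l) + \<xi> * (w k - w l)) =
      cos (\<eta> * v k + \<xi> * w k) * cos (\<eta> * v l + \<xi> * w l) +
      sin (\<eta> * v k + \<xi> * w k) * sin (\<eta> * v l + \<xi> * w l)" for k l
    by (subst cos_diff[symmetric]) (simp add: algebra_simps)
  then show ?thesis
    unfolding trig_form_def power2_eq_square sum_product sum.distrib[symmetric]
    by (intro sum.cong refl) (simp add: algebra_simps)
qed

lemma trig_form_nonneg: "0 \<le> trig_form K m v w \<eta> \<xi>"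
  by (simp add: trig_form_eq_squares)

lemma has_integral_trig_form_gaussian:
  assumes "\<kappa> > 0"
  shows "has_bochner_integral lborel (\<lambda>\<eta>. trig_form K m v w \<eta> \<xi> * exp (- (\<eta> - t)\<^sup>2 / (2 * \<kappa>\<^sup>2)))
     (\<kappa> * sqrt (2 * pi) * (\<Sum>k\<in>K. \<Sum>l\<in>K. m k * m l *
        (exp (- (\<kappa> * (v k - v l))\<^sup>2 / 2) * cos (t * (v k - v l) + \<xi> * (w k - w l)))))"
proof -
  have "has_bochner_integral lborel
    (\<lambda>\<eta>. \<Sum>k\<in>K. \<Sum>l\<in>K. m k * m l *
        (cos (\<eta> * (v k - v l) + \<xi> * (w k - w l)) * exp (- (\<eta> - t)\<^sup>2 / (2 * \<kappa>\<^sup>2))))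
    (\<Sum>k\<in>K. \<Sum>l\<in>K. m k * m l *
        (\<kappa> * sqrt (2 * pi) * exp (- (\<kappa> * (v k - v l))\<^sup>2 / 2) * cos (t * (v k - v l) + \<xi> * (w k - w l))))"
    by (intro has_bochner_integral_sum has_bochner_integral_mult_right has_integral_cos_gaussian assms)
  moreover have "(\<Sum>k\<in>K. \<Sum>l\<in>K. m k * m l *
        (cos (\<eta> * (v k - v l) + \<xi> * (w k - w l)) * exp (- (\<eta> - t)\<^sup>2 / (2 * \<kappa>\<^sup>2))))
      = trig_form K m v w \<eta> \<xi> * exp (- (\<eta> - t)\<^sup>2 / (2 * \<kappa>\<^sup>2))" for \<eta>
    by (simp only: trig_form_def sum_distrib_right mult.assoc)
  moreover have "(\<Sum>k\<in>K. \<Sum>l\<in>K. m k * m l *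
        (\<kappa> * sqrt (2 * pi) * exp (- (\<kappa> * (v k - v l))\<^sup>2 / 2) * cos (t * (v k - v l) + \<xi> * (w k - w l))))
      = \<kappa> * sqrt (2 * pi) * (\<Sum>k\<in>K. \<Sum>l\<in>K. m k * m l *
        (exp (- (\<kappa> * (v k - v l))\<^sup>2 / 2) * cos (t * (v k - v l) + \<xi> * (w k - w l))))"
    by (simp only: sum_distrib_left mult_ac)
  ultimately show ?thesis by (simp only:)
qed

text \<open>
  Reweighting by \<^term>\<open>exp ((v k)\<^sup>2 / 2)\<close> makes the frequency variable average out at unit
  scale in the first coordinate: the Gaussian average of the reweighted form is the
  original form with the kernel \<^term>\<open>exp (v k * v l)\<close>, whose power series
  has nonnegative coefficients.
\<close>

lemma trig_form_le_average:
  fixes m v w :: "'k \<Rightarrow> real"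
  assumes "finite K"
  defines "m' \<equiv> \<lambda>k. m k * exp ((v k)\<^sup>2 / 2)"
  shows "trig_form K m v w t \<xi> \<le>
    (LINT \<eta>|lborel. trig_form K m' v w \<eta> \<xi> * exp (- (\<eta> - t)\<^sup>2 / 2)) / sqrt (2 * pi)"
proof -
  let ?\<theta> = "\<lambda>k. t * v k + \<xi> * w k"
  have "trig_form K m v w t \<xi> \<le>
     (\<Sum>k\<in>K. \<Sum>l\<in>K. (m k * cos (?\<theta> k)) * (m l * cos (?\<theta> l)) * exp (v k * v l)) +
     (\<Sum>k\<in>K. \<Sum>l\<in>K. (m k * sin (?\<theta> k)) * (m l * sin (?\<theta> l)) * exp (v k * v l))"
    unfolding trig_form_eq_squares by (intro add_mono sum_sq_le_exp_form assms)
  also have "\<dots> = (\<Sum>k\<in>K. \<Sum>l\<in>K. m' k * m' l *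
        (exp (- (1 * (v k - v l))\<^sup>2 / 2) * cos (t * (v k - v l) + \<xi> * (w k - w l))))"
    unfolding sum.distrib[symmetric]
  proof (intro sum.cong refl)
    fix k l
    have c: "cos (t * (v k - v l) + \<xi> * (w k - w l)) =
      cos (?\<theta> k) * cos (?\<theta> l) + sin (?\<theta> k) * sin (?\<theta> l)"
      by (subst cos_diff[symmetric]) (simp add: algebra_simps)
    have "v k * v l = (v k)\<^sup>2 / 2 + (v l)\<^sup>2 / 2 + - (1 * (v k - v l))\<^sup>2 / 2"
      by (simp add: power2_diff) (simp add: field_simps)
    then have e: "exp (v k * v l) = exp ((v k)\<^sup>2 / 2) * exp ((v l)\<^sup>2 / 2) * exp (- (1 * (v k - v l))\<^sup>2 / 2)"
      by (simp only: exp_add)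
    show "m k * cos (?\<theta> k) * (m l * cos (?\<theta> l)) * exp (v k * v l) +
        m k * sin (?\<theta> k) * (m l * sin (?\<theta> l)) * exp (v k * v l)
      = m' k * m' l * (exp (- (1 * (v k - v l))\<^sup>2 / 2) * cos (t * (v k - v l) + \<xi> * (w k - w l)))"
      unfolding c e m'_def by algebra
  qed
  also have "\<dots> = (LINT \<eta>|lborel. trig_form K m' v w \<eta> \<xi> * exp (- (\<eta> - t)\<^sup>2 / 2)) / sqrt (2 * pi)"
    using has_bochner_integral_integral_eq[OF has_integral_trig_form_gaussian[of 1 K m' v w \<xi> t]]
    by simp
  finally show ?thesis .
qed

section \<open>Frostman conditions tested against Gaussians\<close>

lemma gaussian_frostman_real:
  fixes X :: "real set" and a :: "real \<Rightarrow> real"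
  assumes X: "finite X" and a: "\<And>x. x \<in> X \<Longrightarrow> 0 \<le> a x"
    and frost: "\<And>y. (\<Sum>x | x \<in> X \<and> \<bar>x - y\<bar> \<le> r. a x) \<le> M" and r: "r > 0"
  shows "(\<Sum>x\<in>X. a x * exp (- ((x - y) / r)\<^sup>2 / 4)) \<le> 256 * M"
proof -
  \<comment> \<open>A constant second coordinate 0 puts all points into one row, so that the
    two-dimensional cell bound applies on the line.\<close>
  have "(\<Sum>x\<in>X. a x * (exp (- ((x - y) / r)\<^sup>2 / 4) * exp (- 0\<^sup>2 / 4))) \<le> 256 * M"
  proof (rule gaussian_sum_le_cells[OF X a])
    fix p q
    have "(\<Sum>x | x \<in> X \<and> \<lfloor>(x - y) / r\<rfloor> = p \<and> \<lfloor>0::real\<rfloor> = q. a x)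
        \<le> (\<Sum>x | x \<in> X \<and> \<bar>x - (y + r * p)\<bar> \<le> r. a x)"
    proof (rule sum_mono2)
      show "{x \<in> X. \<lfloor>(x - y) / r\<rfloor> = p \<and> \<lfloor>0::real\<rfloor> = q} \<subseteq> {x \<in> X. \<bar>x - (y + r * p)\<bar> \<le> r}"
      proof safe
        fix x
        define p where "p = \<lfloor>(x - y) / r\<rfloor>"
        have "p \<le> (x - y) / r" "(x - y) / r \<le> p + 1" unfolding p_def by linarith+
        then have "r * p \<le> x - y" "x - y \<le> r * p + r"
          using r by (auto simp: field_simps)
        then show "\<bar>x - (y + r * p)\<bar> \<le> r" using r by linarith
      qed
    qed (use X a in auto)
    with frost show "(\<Sum>x | x \<in> X \<and> \<lfloor>(x - y) / r\<rfloor> = p \<and> \<lfloor>0::real\<rfloor> = q. a x) \<le> M"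
      using order_trans by blast
  qed
  then show ?thesis by simp
qed

lemma gaussian_frostman_plane:
  fixes v w m :: "'k \<Rightarrow> real"
  assumes K: "finite K" and m: "\<And>k. k \<in> K \<Longrightarrow> 0 \<le> m k"
    and frost: "\<And>v' w'. (\<Sum>k | k \<in> K \<and> \<bar>v k - v'\<bar> \<le> r \<and> \<bar>w k - w'\<bar> \<le> r. m k) \<le> M" and r: "r > 0"
  shows "(\<Sum>k\<in>K. m k * (exp (- ((v k - v') / r)\<^sup>2 / 4) * exp (- ((w k - w') / r)\<^sup>2 / 4))) \<le> 256 * M"
proof (rule gaussian_sum_le_cells[OF K m])
  fix p q
  have cell: "\<bar>u - (y + r * \<lfloor>(u - y) / r\<rfloor>)\<bar> \<le> r" for u y
  proof -
    define p where "p = \<lfloor>(u - y) / r\<rfloor>"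
    have "p \<le> (u - y) / r" "(u - y) / r \<le> p + 1" unfolding p_def by linarith+
    then have "r * p \<le> u - y" "u - y \<le> r * p + r"
      using r by (auto simp: field_simps)
    then show "\<bar>u - (y + r * p)\<bar> \<le> r" using r by linarith
  qed
  have "(\<Sum>k | k \<in> K \<and> \<lfloor>(v k - v') / r\<rfloor> = p \<and> \<lfloor>(w k - w') / r\<rfloor> = q. m k)
      \<le> (\<Sum>k | k \<in> K \<and> \<bar>v k - (v' + r * p)\<bar> \<le> r \<and> \<bar>w k - (w' + r * q)\<bar> \<le> r. m k)"
    by (rule sum_mono2) (use K m cell in auto)
  with frost show "(\<Sum>k | k \<in> K \<and> \<lfloor>(v k - v') / r\<rfloor> = p \<and> \<lfloor>(w k - w') / r\<rfloor> = q. m k) \<le> M"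
    using order_trans by blast
qed

lemma x_exp_minus_le_1: "x * exp (- x) \<le> (1::real)"
proof -
  have "x \<le> exp x" using exp_ge_add_one_self[of x] by linarith
  then show ?thesis by (simp add: exp_minus field_simps)
qed

text \<open>The sum over \<open>x\<close> is essentially the mass of the slopes within about
  \<open>1 / \<bar>\<xi>\<bar>\<close> of \<open>\<eta> / \<xi>\<close>, hence about
  \<open>\<bar>\<xi>\<bar> powr (- \<alpha>)\<close>. Since \<open>\<alpha> \<le> 2\<close>, the
  factor \<open>(\<xi> / R)\<^sup>2\<close> compensates at low frequencies and leaves
  \<open>R powr (- \<alpha>)\<close> uniformly. The Gaussians also confine
  \<open>(\<eta>, \<xi>)\<close> to size about \<open>M * R\<close>.\<close>

lemma frequency_weight_bound:
  fixes X :: "real set" and a :: "real \<Rightarrow> real"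
  assumes X: "finite X" and a: "\<And>x. x \<in> X \<Longrightarrow> 0 \<le> a x"
    and frost: "\<And>y r. \<delta> \<le> r \<Longrightarrow> r \<le> 1 \<Longrightarrow> (\<Sum>x | x \<in> X \<and> \<bar>x - y\<bar> \<le> r. a x) \<le> C * r powr \<alpha>"
    and total: "(\<Sum>x\<in>X. a x) \<le> C"
    and bnd: "\<And>x. x \<in> X \<Longrightarrow> \<bar>x\<bar> \<le> M" and M: "M \<ge> 1"
    and \<alpha>: "\<alpha> \<le> 2" and \<delta>: "\<delta> > 0" and R: "1 \<le> R" "R * \<delta> \<le> 1"
  shows "(\<xi> / R)\<^sup>2 * exp (- \<xi>\<^sup>2 / (2 * R\<^sup>2)) * (\<Sum>x\<in>X. a x * exp (- (\<eta> - \<xi> * x)\<^sup>2 / 2))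
     \<le> 1024 * C * R powr (- \<alpha>) * exp (- (\<eta>\<^sup>2 + \<xi>\<^sup>2) / (16 * M\<^sup>2 * R\<^sup>2))"
proof -
  let ?S = "\<Sum>x\<in>X. a x * exp (- (\<eta> - \<xi> * x)\<^sup>2 / 4)"
  have C: "0 \<le> C" using total a by (meson order_trans sum_nonneg)
  have S0: "0 \<le> ?S" by (intro sum_nonneg mult_nonneg_nonneg a) auto
  have Ss: "?S \<le> C"
  proof -
    have "?S \<le> (\<Sum>x\<in>X. a x * 1)" by (intro sum_mono mult_left_mono a) auto
    with total show ?thesis by simp
  qed
  \<comment> \<open>As a function of \<open>x\<close> the Gaussian has centre
    \<open>\<eta> / \<xi>\<close> and width about \<open>1 / \<bar>\<xi>\<bar>\<close>, so any
    admissible radius at least that large may be used.\<close>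
  have Sr: "?S \<le> 256 * (C * r powr \<alpha>)" if "\<delta> \<le> r" "r \<le> 1" "1 / r \<le> \<bar>\<xi>\<bar>" for r
  proof -
    have r: "r > 0" using that \<delta> by linarith
    have "\<xi> \<noteq> 0" using that r by (auto simp: field_simps)
    have "?S \<le> (\<Sum>x\<in>X. a x * exp (- ((x - \<eta> / \<xi>) / r)\<^sup>2 / 4))"
    proof (intro sum_mono mult_left_mono a)
      fix x assume "x \<in> X"
      have "\<bar>(x - \<eta> / \<xi>) / r\<bar> = \<bar>x - \<eta> / \<xi>\<bar> * (1 / r)" using r by (simp add: abs_divide)
      also have "\<dots> \<le> \<bar>x - \<eta> / \<xi>\<bar> * \<bar>\<xi>\<bar>" by (intro mult_left_mono that) auto
      also have "\<dots> = \<bar>\<eta> - \<xi> * x\<bar>"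
        using \<open>\<xi> \<noteq> 0\<close> by (simp add: abs_mult[symmetric] algebra_simps abs_minus_commute)
      finally have "((x - \<eta> / \<xi>) / r)\<^sup>2 \<le> (\<eta> - \<xi> * x)\<^sup>2" by (simp only: abs_le_square_iff)
      then show "exp (- (\<eta> - \<xi> * x)\<^sup>2 / 4) \<le> exp (- ((x - \<eta> / \<xi>) / r)\<^sup>2 / 4)" by simp
    qed
    also have "\<dots> \<le> 256 * (C * r powr \<alpha>)"
      by (rule gaussian_frostman_real[OF X a frost r]) (use that in auto)
    finally show ?thesis .
  qed
  have main: "(\<xi> / R)\<^sup>2 * exp (- \<xi>\<^sup>2 / (4 * R\<^sup>2)) * ?S \<le> 1024 * C * R powr (- \<alpha>)"
  proof -
    \<comment> \<open>Below 1 only the total mass is available; in the middle range the radius is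
      \<open>1 / \<bar>\<xi>\<bar>\<close>; above \<open>R\<close> it is frozen at
      \<open>1 / R\<close>, still at least \<open>\<delta>\<close>, and the growth of
      \<open>(\<xi> / R)\<^sup>2\<close> is absorbed by the Gaussian.\<close>
    consider "\<bar>\<xi>\<bar> \<le> 1" | "1 < \<bar>\<xi>\<bar>" "\<bar>\<xi>\<bar> \<le> R" | "R < \<bar>\<xi>\<bar>" by linarith
    then show ?thesis
    proof cases
      case 1
      have "(\<xi> / R)\<^sup>2 * exp (- \<xi>\<^sup>2 / (4 * R\<^sup>2)) * ?S \<le> ((1 / R)\<^sup>2 * 1) * C"
        by (intro mult_mono Ss S0) (use 1 R in \<open>auto simp: power_divide divide_simps abs_square_le_1\<close>)
      also have "(1 / R)\<^sup>2 = R powr (- 2)"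
        using R by (simp add: powr_minus power_divide divide_inverse power_inverse)
      also have "\<dots> \<le> R powr (- \<alpha>)" using R \<alpha> by (intro powr_mono) auto
      finally have "(\<xi> / R)\<^sup>2 * exp (- \<xi>\<^sup>2 / (4 * R\<^sup>2)) * ?S \<le> R powr (- \<alpha>) * C"
        using C by (simp add: mult_right_mono)
      also have "\<dots> \<le> 1024 * C * R powr (- \<alpha>)" using C by simp
      finally show ?thesis .
    next
      case 2
      have "1 / R \<le> 1 / \<bar>\<xi>\<bar>" using 2 R by (intro divide_left_mono) auto
      moreover have "\<delta> \<le> 1 / R" using R by (simp add: field_simps)
      ultimately have "?S \<le> 256 * (C * (1 / \<bar>\<xi>\<bar>) powr \<alpha>)" using 2 by (intro Sr) auto
      also have "(1 / \<bar>\<xi>\<bar>) powr \<alpha> = \<bar>\<xi>\<bar> powr (- \<alpha>)"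
        using 2 by (simp add: powr_minus powr_divide inverse_eq_divide)
      finally have "(\<xi> / R)\<^sup>2 * exp (- \<xi>\<^sup>2 / (4 * R\<^sup>2)) * ?S \<le> ((\<xi> / R)\<^sup>2 * 1) * (256 * (C * \<bar>\<xi>\<bar> powr (- \<alpha>)))"
        using S0 by (intro mult_mono) auto
      also have "\<dots> = 256 * C * (\<bar>\<xi>\<bar> powr (2 - \<alpha>) * R powr (- 2))"
        using 2 R by (simp add: power_divide powr_diff powr_minus divide_inverse power_mult_distrib power_inverse mult_ac)
      also have "\<dots> \<le> 256 * C * (R powr (2 - \<alpha>) * R powr (- 2))"
        using C 2 \<alpha> by (intro mult_left_mono mult_right_mono powr_mono2) auto
      also have "\<dots> = 256 * C * R powr (- \<alpha>)" by (simp flip: powr_add)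
      also have "\<dots> \<le> 1024 * C * R powr (- \<alpha>)" using C by (intro mult_right_mono) auto
      finally show ?thesis .
    next
      case 3
      have d: "\<delta> \<le> 1 / R" using R by (simp add: field_simps)
      have "?S \<le> 256 * (C * (1 / R) powr \<alpha>)" using 3 R d by (intro Sr) auto
      also have "(1 / R) powr \<alpha> = R powr (- \<alpha>)"
        using R by (simp add: powr_minus powr_divide inverse_eq_divide)
      finally have S: "?S \<le> 256 * (C * R powr (- \<alpha>))" .
      have "(\<xi> / R)\<^sup>2 * exp (- \<xi>\<^sup>2 / (4 * R\<^sup>2)) = 4 * ((\<xi>\<^sup>2 / (4 * R\<^sup>2)) * exp (- (\<xi>\<^sup>2 / (4 * R\<^sup>2))))"
        by (simp add: power_divide)
      also have "\<dots> \<le> 4 * 1" by (intro mult_left_mono x_exp_minus_le_1) auto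
      finally have "(\<xi> / R)\<^sup>2 * exp (- \<xi>\<^sup>2 / (4 * R\<^sup>2)) * ?S \<le> 4 * (256 * (C * R powr (- \<alpha>)))"
        using S S0 by (intro mult_mono) auto
      then show ?thesis by simp
    qed
  qed
  have R2: "1 \<le> R\<^sup>2" "1 \<le> M\<^sup>2" using R M by (simp_all add: one_le_power)
  \<comment> \<open>Half of each exponent is kept for \<open>main\<close>. The other half is traded
    for decay in \<open>\<eta>\<^sup>2 + \<xi>\<^sup>2\<close>: since
    \<open>\<bar>x\<bar> \<le> M\<close>, a large \<open>\<eta>\<close> forces
    \<open>\<eta> - \<xi> * x\<close> or \<open>\<xi>\<close> to be large.\<close>
  have pt: "exp (- \<xi>\<^sup>2 / (2 * R\<^sup>2)) * exp (- (\<eta> - \<xi> * x)\<^sup>2 / 2) \<le>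
     exp (- \<xi>\<^sup>2 / (4 * R\<^sup>2)) * exp (- (\<eta> - \<xi> * x)\<^sup>2 / 4) * exp (- (\<eta>\<^sup>2 + \<xi>\<^sup>2) / (16 * M\<^sup>2 * R\<^sup>2))"
    if "x \<in> X" for x
  proof -
    let ?d = "(\<eta> - \<xi> * x)\<^sup>2"
    have "x\<^sup>2 \<le> M\<^sup>2" using bnd[OF that] M by (simp add: abs_le_square_iff[symmetric])
    then have "(\<xi> * x)\<^sup>2 \<le> M\<^sup>2 * \<xi>\<^sup>2"
      using mult_left_mono[of "x\<^sup>2" "M\<^sup>2" "\<xi>\<^sup>2"] by (simp add: power_mult_distrib mult.commute)
    moreover have "\<eta>\<^sup>2 \<le> 2 * ?d + 2 * (\<xi> * x)\<^sup>2"
      using sum_squares_ge_zero[of "\<eta> - 2 * (\<xi> * x)" 0] by (simp add: power2_eq_square algebra_simps)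
    moreover have "?d \<le> M\<^sup>2 * ?d" "\<xi>\<^sup>2 \<le> M\<^sup>2 * \<xi>\<^sup>2" using R2 by (simp_all add: mult_le_cancel_right1)
    ultimately have "\<eta>\<^sup>2 + \<xi>\<^sup>2 \<le> M\<^sup>2 * (4 * ?d + 4 * \<xi>\<^sup>2)"
      using zero_le_power2[of "\<eta> - \<xi> * x"] zero_le_power2[of \<xi>]
      unfolding distrib_left mult.left_commute[of "M\<^sup>2" 4] by linarith
    then have "(\<eta>\<^sup>2 + \<xi>\<^sup>2) / (16 * M\<^sup>2 * R\<^sup>2) \<le> M\<^sup>2 * (4 * ?d + 4 * \<xi>\<^sup>2) / (16 * M\<^sup>2 * R\<^sup>2)"
      by (rule divide_right_mono) auto
    also have "\<dots> = (?d / R\<^sup>2 + \<xi>\<^sup>2 / R\<^sup>2) / 4" using R2 M R by (simp add: divide_simps)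
    also have "\<dots> \<le> (?d + \<xi>\<^sup>2 / R\<^sup>2) / 4"
      using R2 mult_left_mono[OF R2(1), of ?d] by (simp add: divide_simps mult.commute)
    finally have "(\<eta>\<^sup>2 + \<xi>\<^sup>2) / (16 * M\<^sup>2 * R\<^sup>2) \<le> (?d + \<xi>\<^sup>2 / R\<^sup>2) / 4" .
    moreover have "- \<xi>\<^sup>2 / (2 * R\<^sup>2) = - (1/2) * (\<xi>\<^sup>2 / R\<^sup>2)" "- \<xi>\<^sup>2 / (4 * R\<^sup>2) = - (1/4) * (\<xi>\<^sup>2 / R\<^sup>2)"
      by simp_all
    moreover have "- (1/2) * e + - d / 2 \<le> - (1/4) * e + - d / 4 + - f / g" if "f / g \<le> (d + e) / 4" for d e f g :: real
      using that by (simp add: add_divide_distrib)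
    ultimately show ?thesis
      unfolding exp_add[symmetric] exp_le_cancel_iff by (simp only:)
  qed
  have "(\<xi> / R)\<^sup>2 * exp (- \<xi>\<^sup>2 / (2 * R\<^sup>2)) * (\<Sum>x\<in>X. a x * exp (- (\<eta> - \<xi> * x)\<^sup>2 / 2))
      = (\<xi> / R)\<^sup>2 * (\<Sum>x\<in>X. a x * (exp (- \<xi>\<^sup>2 / (2 * R\<^sup>2)) * exp (- (\<eta> - \<xi> * x)\<^sup>2 / 2)))"
    by (simp only: sum_distrib_left mult_ac)
  also have "\<dots> \<le> (\<xi> / R)\<^sup>2 * (\<Sum>x\<in>X. a x *
     (exp (- \<xi>\<^sup>2 / (4 * R\<^sup>2)) * exp (- (\<eta> - \<xi> * x)\<^sup>2 / 4) * exp (- (\<eta>\<^sup>2 + \<xi>\<^sup>2) / (16 * M\<^sup>2 * R\<^sup>2))))"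
    by (intro mult_left_mono sum_mono pt a) auto
  also have "\<dots> = (\<xi> / R)\<^sup>2 * exp (- \<xi>\<^sup>2 / (4 * R\<^sup>2)) * ?S * exp (- (\<eta>\<^sup>2 + \<xi>\<^sup>2) / (16 * M\<^sup>2 * R\<^sup>2))"
    by (simp only: sum_distrib_left sum_distrib_right mult_ac)
  also have "\<dots> \<le> 1024 * C * R powr (- \<alpha>) * exp (- (\<eta>\<^sup>2 + \<xi>\<^sup>2) / (16 * M\<^sup>2 * R\<^sup>2))"
    by (intro mult_right_mono main) auto
  finally show ?thesis .
qed

section \<open>The energy of projections\<close>

text \<open>The mass of pairs of points whose projections \<open>x * v + w\<close> agree up to about
  \<open>1 / R\<close>, averaged over the slopes. Multiplied by \<open>R\<close> it is, up to a
  constant factor, the averaged squared L2 norm of the projections smoothed at scale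
  \<open>1 / R\<close>.\<close>

definition projection_energy ::
    "real set \<Rightarrow> (real \<Rightarrow> real) \<Rightarrow> 'k set \<Rightarrow> ('k \<Rightarrow> real) \<Rightarrow> ('k \<Rightarrow> real) \<Rightarrow> ('k \<Rightarrow> real) \<Rightarrow> real \<Rightarrow> real" where
  "projection_energy X a K m v w R = (\<Sum>x\<in>X. a x * (\<Sum>k\<in>K. \<Sum>l\<in>K. m k * m l *
     exp (- (R * (x * (v k - v l) + (w k - w l)))\<^sup>2 / 2)))"

text \<open>The Fourier transform of the projection of slope \<open>x\<close> at frequency
  \<open>\<xi>\<close> is the planar transform at \<open>(\<xi> * x, \<xi>)\<close>, so the energy
  averages \<open>trig_form\<close> over lines through the origin.\<close>

lemma has_integral_projection_energy:
  assumes "R > 0"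
  shows "has_bochner_integral lborel
    (\<lambda>\<xi>. exp (- \<xi>\<^sup>2 / (2 * R\<^sup>2)) * (\<Sum>x\<in>X. a x * trig_form K m v w (\<xi> * x) \<xi>))
    (R * sqrt (2 * pi) * projection_energy X a K m v w R)"
proof -
  have "has_bochner_integral lborel
    (\<lambda>\<xi>. \<Sum>x\<in>X. a x * (\<Sum>k\<in>K. \<Sum>l\<in>K. m k * m l *
        (cos (\<xi> * (x * (v k - v l) + (w k - w l)) + 0) * exp (- (\<xi> - 0)\<^sup>2 / (2 * R\<^sup>2)))))
    (\<Sum>x\<in>X. a x * (\<Sum>k\<in>K. \<Sum>l\<in>K. m k * m l *
        (R * sqrt (2 * pi) * exp (- (R * (x * (v k - v l) + (w k - w l)))\<^sup>2 / 2)
          * cos (0 * (x * (v k - v l) + (w k - w l)) + 0))))"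
    by (intro has_bochner_integral_sum has_bochner_integral_mult_right has_integral_cos_gaussian assms)
  moreover have "(\<Sum>x\<in>X. a x * (\<Sum>k\<in>K. \<Sum>l\<in>K. m k * m l *
        (cos (\<xi> * (x * (v k - v l) + (w k - w l)) + 0) * exp (- (\<xi> - 0)\<^sup>2 / (2 * R\<^sup>2)))))
      = exp (- \<xi>\<^sup>2 / (2 * R\<^sup>2)) * (\<Sum>x\<in>X. a x * trig_form K m v w (\<xi> * x) \<xi>)" for \<xi>
    unfolding trig_form_def sum_distrib_left
    by (intro sum.cong refl) (simp add: distrib_left mult.assoc mult.left_commute mult.commute)
  moreover have "(\<Sum>x\<in>X. a x * (\<Sum>k\<in>K. \<Sum>l\<in>K. m k * m l *
        (R * sqrt (2 * pi) * exp (- (R * (x * (v k - v l) + (w k - w l)))\<^sup>2 / 2)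
          * cos (0 * (x * (v k - v l) + (w k - w l)) + 0))))
      = R * sqrt (2 * pi) * projection_energy X a K m v w R"
    unfolding projection_energy_def sum_distrib_left
    by (intro sum.cong refl) (simp add: mult_ac)
  ultimately show ?thesis by (simp only:)
qed

text \<open>The narrower Gaussian is the wider one times \<open>exp (- t)\<close> with
  \<open>t = 3 / 2 * (\<xi> / R)\<^sup>2\<close>, and \<open>1 - exp (- t) \<le> t\<close>. The
  factor \<open>(\<xi> / R)\<^sup>2\<close> gained here is what suppresses low frequencies in the
  increment.\<close>

lemma gaussian_difference_le:
  fixes R \<xi> :: real
  assumes "R > 0"
  shows "exp (- \<xi>\<^sup>2 / (2 * R\<^sup>2)) - exp (- \<xi>\<^sup>2 / (2 * (R / 2)\<^sup>2))
    \<le> 3 / 2 * ((\<xi> / R)\<^sup>2 * exp (- \<xi>\<^sup>2 / (2 * R\<^sup>2)))"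
proof -
  let ?t = "3 / 2 * (\<xi> / R)\<^sup>2"
  have "- \<xi>\<^sup>2 / (2 * (R / 2)\<^sup>2) = - \<xi>\<^sup>2 / (2 * R\<^sup>2) + - ?t"
    using assms by (simp add: power_divide field_simps)
  then have "exp (- \<xi>\<^sup>2 / (2 * (R / 2)\<^sup>2)) = exp (- \<xi>\<^sup>2 / (2 * R\<^sup>2)) * exp (- ?t)"
    by (simp only: exp_add)
  moreover have "1 - exp (- ?t) \<le> ?t"
    using exp_ge_add_one_self[of "- ?t"] by linarith
  then have "exp (- \<xi>\<^sup>2 / (2 * R\<^sup>2)) * (1 - exp (- ?t)) \<le> exp (- \<xi>\<^sup>2 / (2 * R\<^sup>2)) * ?t"
    by (intro mult_left_mono) auto
  ultimately show ?thesis by (simp add: algebra_simps)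
qed

text \<open>The discrete setting of the projection theorem: slopes of exponent
  \<open>\<alpha>\<close> and planar points \<open>(v k, w k)\<close> of exponent \<open>s\<close>,
  with ball conditions only at scales between \<open>\<delta>\<close> and 1. The constants obtained
  do not depend on \<open>\<delta>\<close> or on the number of points.\<close>

locale frostman_pair =
  fixes X :: "real set" and a :: "real \<Rightarrow> real"
    and K :: "'k set" and m v w :: "'k \<Rightarrow> real"
    and \<delta> \<alpha> s C D M :: real
  assumes finite_X: "finite X" and a_nonneg: "\<And>x. x \<in> X \<Longrightarrow> 0 \<le> a x"
    and frost_X: "\<And>y r. \<delta> \<le> r \<Longrightarrow> r \<le> 1 \<Longrightarrow> (\<Sum>x | x \<in> X \<and> \<bar>x - y\<bar> \<le> r. a x) \<le> C * r powr \<alpha>"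
    and total_X: "(\<Sum>x\<in>X. a x) \<le> C"
    and bound_X: "\<And>x. x \<in> X \<Longrightarrow> \<bar>x\<bar> \<le> M"
    and finite_K: "finite K" and m_nonneg: "\<And>k. k \<in> K \<Longrightarrow> 0 \<le> m k"
    and frost_K: "\<And>v' w' r. \<delta> \<le> r \<Longrightarrow> r \<le> 1 \<Longrightarrow>
      (\<Sum>k | k \<in> K \<and> \<bar>v k - v'\<bar> \<le> r \<and> \<bar>w k - w'\<bar> \<le> r. m k) \<le> D * r powr s"
    and total_K: "(\<Sum>k\<in>K. m k) \<le> D"
    and bound_K: "\<And>k. k \<in> K \<Longrightarrow> \<bar>v k\<bar> \<le> M"
    and M_ge: "M \<ge> 1" and \<alpha>_le: "\<alpha> \<le> 2" and \<delta>_pos: "\<delta> > 0"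
begin

abbreviation "E \<equiv> projection_energy X a K m v w"

text \<open>The weights required by \<open>trig_form_le_average\<close>; as \<open>v\<close> is
  bounded by \<open>M\<close> on \<open>K\<close>, they cost at most a factor
  \<open>exp (M\<^sup>2)\<close> in a double sum.\<close>

definition "m' k = m k * exp ((v k)\<^sup>2 / 2)"

lemma C_nonneg: "0 \<le> C" using total_X a_nonneg by (meson order_trans sum_nonneg)
lemma D_nonneg: "0 \<le> D" using total_K m_nonneg by (meson order_trans sum_nonneg)

text \<open>For fixed \<open>k\<close> the Gaussian in \<open>l\<close> only sees points within
  about \<open>1 / R\<close> of \<open>(v k, w k)\<close>, whose mass is of order
  \<open>R powr (- s)\<close>; the outer sum is bounded by the total mass.\<close>

lemma reweighted_energy_le:
  assumes R: "1 \<le> R" "R * \<delta> \<le> 1"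
  shows "(\<Sum>k\<in>K. \<Sum>l\<in>K. m' k * m' l * exp (- (4 * M\<^sup>2 * R\<^sup>2 * ((v k - v l)\<^sup>2 + (w k - w l)\<^sup>2))))
    \<le> exp (M\<^sup>2) * (256 * D\<^sup>2 * R powr (- s))"
proof -
  have rpos: "1 / R > 0" "\<delta> \<le> 1 / R" "1 / R \<le> 1" using R by (auto simp: field_simps)
  have sq: "(v k)\<^sup>2 \<le> M\<^sup>2" if "k \<in> K" for k
    using bound_K[OF that] M_ge by (simp add: abs_le_square_iff[symmetric])
  have one: "(\<Sum>l\<in>K. m l * exp (- (4 * M\<^sup>2 * R\<^sup>2 * ((v k - v l)\<^sup>2 + (w k - w l)\<^sup>2))))
      \<le> 256 * (D * R powr (- s))" for k
  proof -
    have "(\<Sum>l\<in>K. m l * exp (- (4 * M\<^sup>2 * R\<^sup>2 * ((v k - v l)\<^sup>2 + (w k - w l)\<^sup>2))))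
      \<le> (\<Sum>l\<in>K. m l * (exp (- ((v l - v k) / (1 / R))\<^sup>2 / 4) * exp (- ((w l - w k) / (1 / R))\<^sup>2 / 4)))"
    proof (intro sum_mono mult_left_mono m_nonneg)
      fix l
      let ?q = "R\<^sup>2 * ((v k - v l)\<^sup>2 + (w k - w l)\<^sup>2)"
      have "1 * ?q \<le> M\<^sup>2 * ?q"
        using M_ge by (intro mult_right_mono) (auto simp: one_le_power)
      moreover have "0 \<le> ?q" by simp
      ultimately have "?q / 4 \<le> 4 * (M\<^sup>2 * ?q)" by linarith
      moreover have "?q / 4 = ((v l - v k) / (1 / R))\<^sup>2 / 4 + ((w l - w k) / (1 / R))\<^sup>2 / 4"
        by (simp add: power_mult_distrib power2_commute[of "v k"] power2_commute[of "w k"] distrib_left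
            mult.commute add_divide_distrib)
      ultimately show "exp (- (4 * M\<^sup>2 * R\<^sup>2 * ((v k - v l)\<^sup>2 + (w k - w l)\<^sup>2)))
        \<le> exp (- ((v l - v k) / (1 / R))\<^sup>2 / 4) * exp (- ((w l - w k) / (1 / R))\<^sup>2 / 4)"
        unfolding exp_add[symmetric] exp_le_cancel_iff minus_divide_left[symmetric] mult.assoc by linarith
    qed
    also have "\<dots> \<le> 256 * (D * (1 / R) powr s)"
      by (rule gaussian_frostman_plane[OF finite_K m_nonneg frost_K]) (use rpos in auto)
    also have "(1 / R) powr s = R powr (- s)"
      using R by (simp add: powr_minus powr_divide inverse_eq_divide)
    finally show ?thesis .
  qed
  have "(\<Sum>k\<in>K. \<Sum>l\<in>K. m' k * m' l * exp (- (4 * M\<^sup>2 * R\<^sup>2 * ((v k - v l)\<^sup>2 + (w k - w l)\<^sup>2))))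
      \<le> (\<Sum>k\<in>K. \<Sum>l\<in>K. exp (M\<^sup>2) * (m k * (m l * exp (- (4 * M\<^sup>2 * R\<^sup>2 * ((v k - v l)\<^sup>2 + (w k - w l)\<^sup>2))))))"
  proof (intro sum_mono)
    fix k l assume kl: "k \<in> K" "l \<in> K"
    let ?e = "exp (- (4 * M\<^sup>2 * R\<^sup>2 * ((v k - v l)\<^sup>2 + (w k - w l)\<^sup>2)))"
    have "exp ((v k)\<^sup>2 / 2) * exp ((v l)\<^sup>2 / 2) \<le> exp (M\<^sup>2)"
      using sq[OF kl(1)] sq[OF kl(2)] by (simp flip: exp_add)
    then have "(m k * (m l * ?e)) * (exp ((v k)\<^sup>2 / 2) * exp ((v l)\<^sup>2 / 2)) \<le> (m k * (m l * ?e)) * exp (M\<^sup>2)"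
      using m_nonneg kl by (intro mult_left_mono) auto
    then show "m' k * m' l * ?e \<le> exp (M\<^sup>2) * (m k * (m l * ?e))"
      by (simp add: m'_def mult_ac)
  qed
  also have "\<dots> = exp (M\<^sup>2) * (\<Sum>k\<in>K. m k * (\<Sum>l\<in>K. m l * exp (- (4 * M\<^sup>2 * R\<^sup>2 * ((v k - v l)\<^sup>2 + (w k - w l)\<^sup>2)))))"
    by (simp only: sum_distrib_left)
  also have "\<dots> \<le> exp (M\<^sup>2) * (\<Sum>k\<in>K. m k * (256 * (D * R powr (- s))))"
    by (intro mult_left_mono sum_mono one m_nonneg) auto
  also have "\<dots> = exp (M\<^sup>2) * ((\<Sum>k\<in>K. m k) * (256 * (D * R powr (- s))))"
    by (simp only: sum_distrib_right)
  also have "\<dots> \<le> exp (M\<^sup>2) * (D * (256 * (D * R powr (- s))))"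
    using D_nonneg by (intro mult_left_mono mult_right_mono total_K) auto
  finally show ?thesis by (simp add: power2_eq_square mult_ac)
qed

text \<open>The factors come, in order, from \<open>gaussian_difference_le\<close>,
  \<open>frequency_weight_bound\<close>, the ratio \<open>\<kappa>\<^sup>2 / R\<^sup>2\<close> in
  the increment estimate, and \<open>reweighted_energy_le\<close>.\<close>

definition "const = 3 / 2 * (1024 * C) * (8 * M\<^sup>2) * (exp (M\<^sup>2) * (256 * D\<^sup>2))"

lemma const_nonneg: "0 \<le> const"
  unfolding const_def using C_nonneg by simp

text \<open>In frequency space the increment averages \<open>trig_form\<close> over the lines
  \<open>\<eta> = \<xi> * x\<close> with weight at most \<open>(\<xi> / R)\<^sup>2\<close> times a
  Gaussian, up to a constant. Spreading each line by a unit Gaussian in \<open>\<eta>\<close> and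
  summing over \<open>x\<close> turns the slope weight into a bounded planar density, and a planar
  Gaussian energy remains. The powers of \<open>R\<close> are \<open>- \<alpha>\<close> from the
  density, 2 from the area of the frequency region and \<open>- s\<close> from the energy.\<close>

lemma energy_increment:
  assumes R: "1 \<le> R" "R * \<delta> \<le> 1"
  shows "R * E R - R / 2 * E (R / 2) \<le> const * R powr (2 - \<alpha> - s)"
proof -
  \<comment> \<open>With this choice the decay supplied by \<open>frequency_weight_bound\<close> is
    a Gaussian of deviation \<open>\<kappa>\<close> in each frequency variable.\<close>
  define \<kappa> where "\<kappa> = sqrt 8 * M * R"
  have \<kappa>: "\<kappa> > 0" "2 * \<kappa>\<^sup>2 = 16 * M\<^sup>2 * R\<^sup>2"
    using R M_ge by (simp_all add: \<kappa>_def power_mult_distrib)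
  define H where "H \<xi> = (\<Sum>x\<in>X. a x * trig_form K m v w (\<xi> * x) \<xi>)" for \<xi>
  define c where "c = 1024 * C * R powr (- \<alpha>)"
  have c0: "0 \<le> c" unfolding c_def using C_nonneg by simp
  define G where "G \<xi> = (\<Sum>k\<in>K. \<Sum>l\<in>K. m' k * m' l * (exp (- (\<kappa> * (v k - v l))\<^sup>2 / 2) * cos (\<xi> * (w k - w l))))" for \<xi>
  have H0: "0 \<le> H \<xi>" for \<xi>
    unfolding H_def by (intro sum_nonneg mult_nonneg_nonneg a_nonneg trig_form_nonneg)
  have I1: "integrable lborel (\<lambda>\<eta>. trig_form K m' v w \<eta> \<xi> * exp (- (\<eta> - t)\<^sup>2 / 2))" for \<xi> t
    using has_integral_trig_form_gaussian[of 1 K m' v w \<xi> t]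
    by (simp add: has_bochner_integral_iff)
  have I2: "integrable lborel (\<lambda>\<eta>. trig_form K m' v w \<eta> \<xi> * exp (- \<eta>\<^sup>2 / (16 * M\<^sup>2 * R\<^sup>2)))"
    and V2: "(LINT \<eta>|lborel. trig_form K m' v w \<eta> \<xi> * exp (- \<eta>\<^sup>2 / (16 * M\<^sup>2 * R\<^sup>2))) = \<kappa> * sqrt (2 * pi) * G \<xi>" for \<xi>
    using has_integral_trig_form_gaussian[OF \<kappa>(1), of K m' v w \<xi> 0]
    by (simp_all add: has_bochner_integral_iff \<kappa>(2) G_def)
  \<comment> \<open>At fixed \<open>\<xi>\<close> the finite sum over slopes is moved inside the
    \<open>\<eta>\<close> integral, where its combined weight is bounded before integrating.\<close>
  have pointwise: "(\<xi> / R)\<^sup>2 * exp (- \<xi>\<^sup>2 / (2 * R\<^sup>2)) * H \<xi> \<le> c * \<kappa> * (exp (- \<xi>\<^sup>2 / (2 * \<kappa>\<^sup>2)) * G \<xi>)" for \<xi>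
  proof -
    let ?q = "(\<xi> / R)\<^sup>2 * exp (- \<xi>\<^sup>2 / (2 * R\<^sup>2))"
    let ?F = "\<lambda>\<eta>. trig_form K m' v w \<eta> \<xi>"
    have "H \<xi> \<le> (\<Sum>x\<in>X. a x * ((LINT \<eta>|lborel. ?F \<eta> * exp (- (\<eta> - \<xi> * x)\<^sup>2 / 2)) / sqrt (2 * pi)))"
      unfolding H_def m'_def[abs_def]
      by (intro sum_mono mult_left_mono trig_form_le_average finite_K a_nonneg)
    also have "\<dots> = (LINT \<eta>|lborel. (\<Sum>x\<in>X. a x * (?F \<eta> * exp (- (\<eta> - \<xi> * x)\<^sup>2 / 2)))) / sqrt (2 * pi)"
      by (subst Bochner_Integration.integral_sum)
         (intro integrable_mult_right I1, simp only: integral_mult_right_zero sum_divide_distrib times_divide_eq_right)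
    finally have "?q * H \<xi> \<le> ?q * ((LINT \<eta>|lborel. (\<Sum>x\<in>X. a x * (?F \<eta> * exp (- (\<eta> - \<xi> * x)\<^sup>2 / 2)))) / sqrt (2 * pi))"
      by (rule mult_left_mono) auto
    also have "\<dots> = (LINT \<eta>|lborel. ?q * (\<Sum>x\<in>X. a x * (?F \<eta> * exp (- (\<eta> - \<xi> * x)\<^sup>2 / 2)))) / sqrt (2 * pi)"
      unfolding integral_mult_right_zero by simp
    also have "\<dots> \<le> (LINT \<eta>|lborel. c * exp (- \<xi>\<^sup>2 / (16 * M\<^sup>2 * R\<^sup>2)) * (?F \<eta> * exp (- \<eta>\<^sup>2 / (16 * M\<^sup>2 * R\<^sup>2)))) / sqrt (2 * pi)"
    proof (intro divide_right_mono integral_mono)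
      show "integrable lborel (\<lambda>\<eta>. ?q * (\<Sum>x\<in>X. a x * (?F \<eta> * exp (- (\<eta> - \<xi> * x)\<^sup>2 / 2))))"
        by (intro integrable_mult_right Bochner_Integration.integrable_sum I1)
      show "integrable lborel (\<lambda>\<eta>. c * exp (- \<xi>\<^sup>2 / (16 * M\<^sup>2 * R\<^sup>2)) * (?F \<eta> * exp (- \<eta>\<^sup>2 / (16 * M\<^sup>2 * R\<^sup>2))))"
        by (intro integrable_mult_right I2)
      fix \<eta>
      have "?q * (\<Sum>x\<in>X. a x * (?F \<eta> * exp (- (\<eta> - \<xi> * x)\<^sup>2 / 2)))
          = ?F \<eta> * (?q * (\<Sum>x\<in>X. a x * exp (- (\<eta> - \<xi> * x)\<^sup>2 / 2)))"
        by (simp only: sum_distrib_left mult_ac)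
      also have "\<dots> \<le> ?F \<eta> * (c * exp (- (\<eta>\<^sup>2 + \<xi>\<^sup>2) / (16 * M\<^sup>2 * R\<^sup>2)))"
        unfolding c_def
        by (intro mult_left_mono trig_form_nonneg frequency_weight_bound[where \<delta> = \<delta>] finite_X a_nonneg
            frost_X total_X bound_X M_ge \<alpha>_le \<delta>_pos R)
      also have "exp (- (\<eta>\<^sup>2 + \<xi>\<^sup>2) / (16 * M\<^sup>2 * R\<^sup>2))
          = exp (- \<xi>\<^sup>2 / (16 * M\<^sup>2 * R\<^sup>2)) * exp (- \<eta>\<^sup>2 / (16 * M\<^sup>2 * R\<^sup>2))"
        unfolding exp_add[symmetric] by (simp add: diff_divide_distrib)
      finally show "?q * (\<Sum>x\<in>X. a x * (?F \<eta> * exp (- (\<eta> - \<xi> * x)\<^sup>2 / 2)))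
          \<le> c * exp (- \<xi>\<^sup>2 / (16 * M\<^sup>2 * R\<^sup>2)) * (?F \<eta> * exp (- \<eta>\<^sup>2 / (16 * M\<^sup>2 * R\<^sup>2)))"
        by (simp only: mult_ac)
    qed simp
    also have "\<dots> = c * \<kappa> * (exp (- \<xi>\<^sup>2 / (2 * \<kappa>\<^sup>2)) * G \<xi>)"
      unfolding integral_mult_right_zero V2 \<kappa>(2) by simp
    finally show ?thesis .
  qed
  let ?S = "\<Sum>k\<in>K. \<Sum>l\<in>K. m' k * m' l * exp (- (4 * M\<^sup>2 * R\<^sup>2 * ((v k - v l)\<^sup>2 + (w k - w l)\<^sup>2)))"
  \<comment> \<open>Integration over \<open>\<xi>\<close> turns the cosines in \<open>w\<close> into
    the second Gaussian factor of \<open>?S\<close>, completing the planar energy.\<close>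
  have G: "has_bochner_integral lborel (\<lambda>\<xi>. exp (- \<xi>\<^sup>2 / (2 * \<kappa>\<^sup>2)) * G \<xi>) (\<kappa> * sqrt (2 * pi) * ?S)"
  proof -
    have "has_bochner_integral lborel
      (\<lambda>\<xi>. \<Sum>k\<in>K. \<Sum>l\<in>K. (m' k * m' l * exp (- (\<kappa> * (v k - v l))\<^sup>2 / 2)) *
          (cos (\<xi> * (w k - w l) + 0) * exp (- (\<xi> - 0)\<^sup>2 / (2 * \<kappa>\<^sup>2))))
      (\<Sum>k\<in>K. \<Sum>l\<in>K. (m' k * m' l * exp (- (\<kappa> * (v k - v l))\<^sup>2 / 2)) *
          (\<kappa> * sqrt (2 * pi) * exp (- (\<kappa> * (w k - w l))\<^sup>2 / 2) * cos (0 * (w k - w l) + 0)))"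
      by (intro has_bochner_integral_sum has_bochner_integral_mult_right has_integral_cos_gaussian \<kappa>)
    moreover have "(\<Sum>k\<in>K. \<Sum>l\<in>K. (m' k * m' l * exp (- (\<kappa> * (v k - v l))\<^sup>2 / 2)) *
          (cos (\<xi> * (w k - w l) + 0) * exp (- (\<xi> - 0)\<^sup>2 / (2 * \<kappa>\<^sup>2)))) = exp (- \<xi>\<^sup>2 / (2 * \<kappa>\<^sup>2)) * G \<xi>" for \<xi>
      unfolding G_def sum_distrib_left by (intro sum.cong refl) (simp add: mult_ac)
    moreover have "(\<Sum>k\<in>K. \<Sum>l\<in>K. (m' k * m' l * exp (- (\<kappa> * (v k - v l))\<^sup>2 / 2)) *
          (\<kappa> * sqrt (2 * pi) * exp (- (\<kappa> * (w k - w l))\<^sup>2 / 2) * cos (0 * (w k - w l) + 0)))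
        = \<kappa> * sqrt (2 * pi) * ?S"
      unfolding sum_distrib_left
    proof (intro sum.cong refl)
      fix k l
      have "- (4 * M\<^sup>2 * R\<^sup>2 * ((v k - v l)\<^sup>2 + (w k - w l)\<^sup>2))
          = - (\<kappa> * (v k - v l))\<^sup>2 / 2 + - (\<kappa> * (w k - w l))\<^sup>2 / 2"
      proof -
        have "(\<kappa> * z)\<^sup>2 / 2 = 4 * M\<^sup>2 * R\<^sup>2 * z\<^sup>2" for z
          using \<kappa>(2) by (simp add: power_mult_distrib)
        then show ?thesis by (simp add: distrib_left)
      qed
      then have "exp (- (4 * M\<^sup>2 * R\<^sup>2 * ((v k - v l)\<^sup>2 + (w k - w l)\<^sup>2)))
          = exp (- (\<kappa> * (v k - v l))\<^sup>2 / 2) * exp (- (\<kappa> * (w k - w l))\<^sup>2 / 2)"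
        by (simp only: exp_add)
      then show "m' k * m' l * exp (- (\<kappa> * (v k - v l))\<^sup>2 / 2) *
          (\<kappa> * sqrt (2 * pi) * exp (- (\<kappa> * (w k - w l))\<^sup>2 / 2) * cos (0 * (w k - w l) + 0))
        = \<kappa> * sqrt (2 * pi) * (m' k * m' l * exp (- (4 * M\<^sup>2 * R\<^sup>2 * ((v k - v l)\<^sup>2 + (w k - w l)\<^sup>2))))"
        by (simp only: mult_ac mult_zero_left add_0_left cos_zero mult_1_right mult_1_left)
    qed
    ultimately show ?thesis by (simp only:)
  qed
  have R2: "R / 2 > 0" "R > 0" using R by auto
  have Hi: "has_bochner_integral lborel
      (\<lambda>\<xi>. exp (- \<xi>\<^sup>2 / (2 * R\<^sup>2)) * H \<xi> - exp (- \<xi>\<^sup>2 / (2 * (R / 2)\<^sup>2)) * H \<xi>)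
      (R * sqrt (2 * pi) * E R - R / 2 * sqrt (2 * pi) * E (R / 2))"
    unfolding H_def by (intro has_bochner_integral_diff has_integral_projection_energy R2)
  have "R * sqrt (2 * pi) * E R - R / 2 * sqrt (2 * pi) * E (R / 2)
      \<le> 3 / 2 * (c * \<kappa>) * (\<kappa> * sqrt (2 * pi) * ?S)"
    unfolding has_bochner_integral_integral_eq[OF Hi, symmetric]
      has_bochner_integral_integral_eq[OF has_bochner_integral_mult_right[OF G], symmetric]
  proof (rule integral_mono)
    show "integrable lborel (\<lambda>\<xi>. exp (- \<xi>\<^sup>2 / (2 * R\<^sup>2)) * H \<xi> - exp (- \<xi>\<^sup>2 / (2 * (R / 2)\<^sup>2)) * H \<xi>)"
      using Hi by (rule integrable.intros)
    show "integrable lborel (\<lambda>\<xi>. 3 / 2 * (c * \<kappa>) * (exp (- \<xi>\<^sup>2 / (2 * \<kappa>\<^sup>2)) * G \<xi>))"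
      using has_bochner_integral_mult_right[OF G] by (rule integrable.intros)
    fix \<xi>
    have "exp (- \<xi>\<^sup>2 / (2 * R\<^sup>2)) * H \<xi> - exp (- \<xi>\<^sup>2 / (2 * (R / 2)\<^sup>2)) * H \<xi>
        \<le> 3 / 2 * ((\<xi> / R)\<^sup>2 * exp (- \<xi>\<^sup>2 / (2 * R\<^sup>2))) * H \<xi>"
      unfolding left_diff_distrib[symmetric]
      by (intro mult_right_mono gaussian_difference_le H0 R2)
    also have "\<dots> = 3 / 2 * ((\<xi> / R)\<^sup>2 * exp (- \<xi>\<^sup>2 / (2 * R\<^sup>2)) * H \<xi>)" by (simp only: mult.assoc)
    also have "\<dots> \<le> 3 / 2 * (c * \<kappa> * (exp (- \<xi>\<^sup>2 / (2 * \<kappa>\<^sup>2)) * G \<xi>))"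
      by (intro mult_left_mono pointwise) auto
    finally show "exp (- \<xi>\<^sup>2 / (2 * R\<^sup>2)) * H \<xi> - exp (- \<xi>\<^sup>2 / (2 * (R / 2)\<^sup>2)) * H \<xi>
        \<le> 3 / 2 * (c * \<kappa>) * (exp (- \<xi>\<^sup>2 / (2 * \<kappa>\<^sup>2)) * G \<xi>)"
      by (simp only: mult.assoc)
  qed
  then have "(R * E R - R / 2 * E (R / 2)) * sqrt (2 * pi) \<le> (3 / 2 * c * \<kappa>\<^sup>2 * ?S) * sqrt (2 * pi)"
    by (simp add: algebra_simps power2_eq_square)
  then have "R * E R - R / 2 * E (R / 2) \<le> 3 / 2 * c * \<kappa>\<^sup>2 * ?S"
    by (rule mult_right_le_imp_le) simp
  also have "\<dots> \<le> 3 / 2 * c * \<kappa>\<^sup>2 * (exp (M\<^sup>2) * (256 * D\<^sup>2 * R powr (- s)))"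
    using c0 by (intro mult_left_mono reweighted_energy_le R) auto
  also have "\<dots> = const * (R powr (- \<alpha>) * R\<^sup>2 * R powr (- s))"
  proof -
    have "\<kappa>\<^sup>2 = 8 * M\<^sup>2 * R\<^sup>2" using \<kappa>(2) by simp
    then show ?thesis unfolding c_def const_def by algebra
  qed
  also have "R powr (- \<alpha>) * R\<^sup>2 * R powr (- s) = R powr (2 - \<alpha> - s)"
  proof -
    have "R powr (2 - \<alpha> - s) = R powr (- \<alpha> + 2 + - s)" by (simp add: algebra_simps)
    also have "\<dots> = R powr (- \<alpha>) * R powr 2 * R powr (- s)" by (simp only: powr_add)
    finally show ?thesis using R by simp
  qed
  finally show ?thesis .
qed

end

context frostman_pair begin

lemma energy_one_le: "E 1 \<le> C * D\<^sup>2"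
proof -
  have inner: "(\<Sum>k\<in>K. \<Sum>l\<in>K. m k * m l * exp (- (1 * (x * (v k - v l) + (w k - w l)))\<^sup>2 / 2)) \<le> D\<^sup>2" for x
  proof -
    have "(\<Sum>k\<in>K. \<Sum>l\<in>K. m k * m l * exp (- (1 * (x * (v k - v l) + (w k - w l)))\<^sup>2 / 2))
        \<le> (\<Sum>k\<in>K. \<Sum>l\<in>K. m k * m l * 1)"
      using m_nonneg by (intro sum_mono mult_left_mono) auto
    also have "\<dots> = (\<Sum>k\<in>K. m k)\<^sup>2" by (simp add: power2_eq_square sum_product)
    also have "\<dots> \<le> D\<^sup>2" using m_nonneg by (intro power_mono total_K sum_nonneg)
    finally show ?thesis .
  qed
  have "E 1 \<le> (\<Sum>x\<in>X. a x * D\<^sup>2)"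
    unfolding projection_energy_def by (intro sum_mono mult_left_mono inner a_nonneg)
  also have "\<dots> \<le> C * D\<^sup>2"
    unfolding sum_distrib_right[symmetric] by (intro mult_right_mono total_X) auto
  finally show ?thesis .
qed

text \<open>The increments are telescoped over dyadic \<open>R\<close>. They are dominated by a
  geometric series of ratio \<open>2 powr (2 - \<alpha> - s)\<close>, which is below 1 precisely
  because \<open>\<alpha> + s > 2\<close>.\<close>

lemma energy_bound:
  assumes s: "\<alpha> + s > 2" and n: "2 ^ n * \<delta> \<le> 1"
  shows "2 ^ n * E (2 ^ n) \<le> C * D\<^sup>2 + const / (1 - 2 powr (2 - \<alpha> - s))"
proof -
  define q where "q = 2 powr (2 - \<alpha> - s)"
  have q: "0 < q" "q < 1"
    using s powr_less_mono[of "2 - \<alpha> - s" 0 2] by (auto simp: q_def)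
  have "2 ^ n * E (2 ^ n) \<le> E 1 + const * (\<Sum>i\<in>{1..n}. q ^ i)"
    using n
  proof (induction n)
    case (Suc n)
    have le: "2 ^ n * \<delta> \<le> 2 ^ Suc n * \<delta>" using \<delta>_pos by (intro mult_right_mono) auto
    have "2 ^ Suc n * E (2 ^ Suc n) - 2 ^ Suc n / 2 * E (2 ^ Suc n / 2) \<le> const * (2 ^ Suc n) powr (2 - \<alpha> - s)"
      by (rule energy_increment[OF one_le_power]) (use Suc.prems in auto)
    also have "(2 ^ Suc n) powr (2 - \<alpha> - s) = q ^ Suc n"
      unfolding q_def powr_realpow[OF zero_less_numeral, symmetric] powr_powr
      by (subst powr_realpow[symmetric]) (auto simp: powr_powr mult.commute)
    finally show ?case using Suc.IH le Suc.prems by (simp add: distrib_left)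
  qed simp
  also have "\<dots> \<le> C * D\<^sup>2 + const * (1 / (1 - q))"
  proof (intro add_mono energy_one_le mult_left_mono const_nonneg)
    have "(\<Sum>i\<in>{1..n}. q ^ i) \<le> (\<Sum>i\<in>{..n}. q ^ i)"
      using q by (intro sum_mono2) auto
    also have "\<dots> \<le> 1 / (1 - q)"
      using q sum_gp_basic[of q n] by (simp add: pos_le_divide_eq mult.commute)
    finally show "(\<Sum>i\<in>{1..n}. q ^ i) \<le> 1 / (1 - q)" .
  qed
  finally show ?thesis by (simp add: q_def)
qed

end

section \<open>Counting cells by the energy\<close>

lemma sum_square_le_card_cells:
  fixes m :: "'k \<Rightarrow> real" and t :: "'k \<Rightarrow> real" and R :: real
  assumes K: "finite K" and m: "\<And>k. k \<in> K \<Longrightarrow> 0 \<le> m k"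
    and P: "finite P" and t: "\<And>k. k \<in> K \<Longrightarrow> \<lfloor>R * t k\<rfloor> \<in> P"
  shows "(\<Sum>k\<in>K. m k)\<^sup>2 \<le> card P * (exp (1/2) *
    (\<Sum>k\<in>K. \<Sum>l\<in>K. m k * m l * exp (- (R * (t k - t l))\<^sup>2 / 2)))"
proof -
  let ?c = "\<lambda>k. \<lfloor>R * t k\<rfloor>"
  let ?M = "\<lambda>p. \<Sum>k\<in>K. if ?c k = p then m k else 0"
  have "(\<Sum>k\<in>K. m k) = (\<Sum>k\<in>K. \<Sum>p\<in>P. if ?c k = p then m k else 0)"
    using t P by (intro sum.cong refl) (simp add: sum.delta)
  also have "\<dots> = (\<Sum>p\<in>P. ?M p)" by (rule sum.swap)
  finally have "(\<Sum>k\<in>K. m k)\<^sup>2 = (\<Sum>p\<in>P. 1 * ?M p)\<^sup>2" by simp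
  \<comment> \<open>Cauchy-Schwarz over the cells: a weight carried by few cells has many pairs in a
    common cell.\<close>
  also have "\<dots> \<le> (\<Sum>p\<in>P. 1\<^sup>2) * (\<Sum>p\<in>P. (?M p)\<^sup>2)"
    by (rule Cauchy_Schwarz_ineq_sum)
  also have "(\<Sum>p\<in>P. (?M p)\<^sup>2) = (\<Sum>p\<in>P. \<Sum>k\<in>K. \<Sum>l\<in>K. if ?c k = p then (if ?c l = p then m k * m l else 0) else 0)"
    unfolding power2_eq_square sum_product by (intro sum.cong refl) auto
  also have "\<dots> = (\<Sum>k\<in>K. \<Sum>p\<in>P. \<Sum>l\<in>K. if ?c k = p then (if ?c l = p then m k * m l else 0) else 0)"
    by (rule sum.swap)
  also have "\<dots> = (\<Sum>k\<in>K. \<Sum>l\<in>K. \<Sum>p\<in>P. if ?c k = p then (if ?c l = p then m k * m l else 0) else 0)"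
    by (intro sum.cong refl sum.swap)
  also have "\<dots> \<le> (\<Sum>k\<in>K. \<Sum>l\<in>K. exp (1/2) * (m k * m l * exp (- (R * (t k - t l))\<^sup>2 / 2)))"
  proof (intro sum_mono)
    fix k l assume kl: "k \<in> K" "l \<in> K"
    have "(\<Sum>p\<in>P. if ?c k = p then (if ?c l = p then m k * m l else 0) else 0) = (if ?c l = ?c k then m k * m l else 0)"
      using t[OF kl(1)] P by (simp add: sum.delta)
    also have "\<dots> \<le> exp (1/2) * (m k * m l * exp (- (R * (t k - t l))\<^sup>2 / 2))"
    proof (cases "?c l = ?c k")
      case True
      \<comment> \<open>Two values in one cell differ by at most \<open>1 / R\<close>, so their
        Gaussian is at least \<open>exp (- 1 / 2)\<close>; this is the origin of the factor
        \<open>exp (1/2)\<close>.\<close>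
      then have "\<bar>R * (t k - t l)\<bar> \<le> 1" unfolding right_diff_distrib by linarith
      then have "(R * (t k - t l))\<^sup>2 \<le> 1" by (simp add: abs_square_le_1)
      then have "1 \<le> exp (1/2) * exp (- (R * (t k - t l))\<^sup>2 / 2)" by (simp flip: exp_add)
      then have "(m k * m l) * 1 \<le> (m k * m l) * (exp (1/2) * exp (- (R * (t k - t l))\<^sup>2 / 2))"
        using m kl by (intro mult_left_mono) auto
      then show ?thesis using True by (simp add: mult_ac)
    next
      case False
      then show ?thesis using m kl by simp
    qed
    finally show "(\<Sum>p\<in>P. if ?c k = p then (if ?c l = p then m k * m l else 0) else 0)
      \<le> exp (1/2) * (m k * m l * exp (- (R * (t k - t l))\<^sup>2 / 2))" .
  qed
  finally show ?thesis by (simp add: sum_distrib_left mult_left_mono)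
qed

context frostman_pair begin

text \<open>For a fixed slope the term \<open>r x\<close> translates the whole projection and
  cancels in differences, so terms of the polynomial in the singled-out variable alone never enter
  the energy.\<close>

lemma mass_le_card_cells:
  assumes P: "finite P" and cell: "\<And>x k. x \<in> X \<Longrightarrow> k \<in> K \<Longrightarrow> \<lfloor>R * (r x + (x * v k + w k))\<rfloor> \<in> P"
  shows "(\<Sum>x\<in>X. a x) * (\<Sum>k\<in>K. m k)\<^sup>2 \<le> card P * (exp (1/2) * E R)"
proof -
  have "(\<Sum>k\<in>K. m k)\<^sup>2 \<le> card P * (exp (1/2) *
      (\<Sum>k\<in>K. \<Sum>l\<in>K. m k * m l * exp (- (R * (x * (v k - v l) + (w k - w l)))\<^sup>2 / 2)))" if "x \<in> X" for x
  proof -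
    have diff: "(r x + (x * v k + w k)) - (r x + (x * v l + w l)) = x * (v k - v l) + (w k - w l)" for k l
      by (simp add: algebra_simps)
    show ?thesis
      using sum_square_le_card_cells[where m = m and R = R and t = "\<lambda>k. r x + (x * v k + w k)",
          OF finite_K m_nonneg P cell[OF that]]
      unfolding diff .
  qed
  then have "(\<Sum>x\<in>X. a x * (\<Sum>k\<in>K. m k)\<^sup>2) \<le> (\<Sum>x\<in>X. a x * (card P * (exp (1/2) *
      (\<Sum>k\<in>K. \<Sum>l\<in>K. m k * m l * exp (- (R * (x * (v k - v l) + (w k - w l)))\<^sup>2 / 2)))))"
    by (intro sum_mono mult_left_mono a_nonneg)
  also have "\<dots> = card P * (exp (1/2) * E R)"
    unfolding projection_energy_def sum_distrib_left by (simp only: mult_ac)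
  finally show ?thesis by (simp only: sum_distrib_right)
qed

end

section \<open>Discrete Frostman weights\<close>

definition dyadic :: "nat \<Rightarrow> int \<Rightarrow> real set" where
  "dyadic n k = {x. \<lfloor>x * 2 ^ n\<rfloor> = k}"

lemma dyadic_eq_interval: "dyadic n k = {real_of_int k / 2 ^ n ..< (real_of_int k + 1) / 2 ^ n}"
  by (auto simp: dyadic_def floor_eq_iff field_simps)

lemma dyadic_Suc: "dyadic n k = dyadic (Suc n) (2 * k) \<union> dyadic (Suc n) (2 * k + 1)"
proof -
  have "\<lfloor>y\<rfloor> = k \<longleftrightarrow> \<lfloor>2 * y\<rfloor> = 2 * k \<or> \<lfloor>2 * y\<rfloor> = 2 * k + 1" for y :: real
    by (simp add: floor_eq_iff) linarith
  from this[of "_ * 2 ^ n"] show ?thesis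
    by (auto simp: dyadic_def mult_ac)
qed

text \<open>The index of the coarser cell around a point is obtained from the finer index by integer
  division by \<open>2 ^ (n' - n)\<close>.\<close>

lemma dyadic_subset_or_disjoint:
  assumes "n \<le> n'"
  shows "dyadic n' k' \<subseteq> dyadic n k \<or> dyadic n' k' \<inter> dyadic n k = {}"
proof -
  obtain e where e: "n' = n + e" using assms le_Suc_ex by blast
  have "\<lfloor>x * 2 ^ n\<rfloor> = k' div 2 ^ e" if "x \<in> dyadic n' k'" for x
  proof -
    have "x * 2 ^ n = (x * 2 ^ n') / real_of_int (2 ^ e)"
      by (simp add: e power_add)
    also have "\<lfloor>\<dots>\<rfloor> = \<lfloor>x * 2 ^ n'\<rfloor> div 2 ^ e"
      by (rule floor_divide_real_eq_div) simp
    finally show ?thesis using that by (simp add: dyadic_def)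
  qed
  then show ?thesis by (auto simp: dyadic_def)
qed

lemma sum_UN_le:
  fixes f :: "'b \<Rightarrow> real"
  assumes "finite I" "\<And>i. i \<in> I \<Longrightarrow> finite (S i)" "\<And>x. 0 \<le> f x"
  shows "sum f (\<Union>i\<in>I. S i) \<le> (\<Sum>i\<in>I. sum f (S i))"
  using assms(1,2)
proof (induction I rule: finite_induct)
  case (insert i I)
  have "sum f (S i \<union> (\<Union>i\<in>I. S i)) \<le> sum f (S i) + sum f (\<Union>i\<in>I. S i)"
    using insert assms(3) by (subst sum_Un) (auto intro!: sum_nonneg)
  then show ?case using insert by simp
qed simp

text \<open>A flow with a cut certificate on the binary tree of dyadic intervals below
  \<open>dyadic n k\<close>, truncated at level \<open>N\<close>: capacities are
  \<open>(1/2) powr (s * n')\<close>, and \<open>J\<close> is a cover whose total capacity is at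
  most the mass carried. A lower bound on covers thereby becomes a lower bound on mass.\<close>

definition tree_measure ::
    "real \<Rightarrow> nat \<Rightarrow> real set \<Rightarrow> nat \<Rightarrow> int \<Rightarrow> real set \<Rightarrow> (real \<Rightarrow> real) \<Rightarrow> (nat \<times> int) set \<Rightarrow> bool" where
  "tree_measure s N A n k X a J \<longleftrightarrow>
    finite X \<and> X \<subseteq> A \<inter> dyadic n k \<and> (\<forall>x. 0 \<le> a x) \<and>
    (\<forall>n' k'. n \<le> n' \<longrightarrow> n' \<le> N \<longrightarrow> sum a (X \<inter> dyadic n' k') \<le> (1/2) powr (s * n')) \<and>
    finite J \<and> A \<inter> dyadic n k \<subseteq> (\<Union>(n', k')\<in>J. dyadic n' k') \<and>
    (\<Sum>(n', k')\<in>J. (1/2) powr (s * real n')) \<le> sum a X"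

lemma tree_measureD:
  assumes "tree_measure s N A n k X a J"
  shows "finite X" "X \<subseteq> A \<inter> dyadic n k" "\<And>x. 0 \<le> a x"
    "\<And>n' k'. n \<le> n' \<Longrightarrow> n' \<le> N \<Longrightarrow> sum a (X \<inter> dyadic n' k') \<le> (1/2) powr (s * n')"
    "finite J" "A \<inter> dyadic n k \<subseteq> (\<Union>(n', k')\<in>J. dyadic n' k')"
    "(\<Sum>(n', k')\<in>J. (1/2) powr (s * real n')) \<le> sum a X"
  using assms unfolding tree_measure_def by blast+

text \<open>Max-flow min-cut, by induction from the leaves upwards. A leaf meeting \<open>A\<close>
  carries its full capacity on one point. At an inner node the weights of the two halves are joined;
  if they exceed the capacity, they are scaled down to it and the node itself becomes the
  certificate, otherwise the certificates are joined.\<close>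

lemma ex_tree_measure:
  assumes "n + d = N"
  shows "\<exists>X a J. tree_measure s N A n k X a J"
  using assms
proof (induction d arbitrary: n k)
  case 0
  show ?case
  proof (cases "A \<inter> dyadic n k = {}")
    case True
    then show ?thesis unfolding tree_measure_def by (intro exI[of _ "{}"] exI[of _ "\<lambda>_. 0"]) auto
  next
    case False
    then obtain x where x: "x \<in> A" "x \<in> dyadic n k" by auto
    show ?thesis unfolding tree_measure_def
      by (intro exI[of _ "{x}"] exI[of _ "\<lambda>_. (1/2) powr (s * n)"] exI[of _ "{(n, k)}"])
         (use x 0 in \<open>auto simp: Int_insert_left\<close>)
  qed
next
  case (Suc d)
  let ?L = "dyadic (Suc n) (2 * k)" and ?R = "dyadic (Suc n) (2 * k + 1)"
  from Suc.IH[of "Suc n" "2 * k"] Suc.prems obtain X1 a1 J1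
    where "tree_measure s N A (Suc n) (2 * k) X1 a1 J1" by auto
  note 1 = tree_measureD[OF this]
  from Suc.IH[of "Suc n" "2 * k + 1"] Suc.prems obtain X2 a2 J2
    where "tree_measure s N A (Suc n) (2 * k + 1) X2 a2 J2" by auto
  note 2 = tree_measureD[OF this]
  define a where "a x = (if x \<in> ?L then a1 x else a2 x)" for x
  let ?X = "X1 \<union> X2"
  have disj: "?L \<inter> ?R = {}" by (auto simp: dyadic_def)
  have a0: "0 \<le> a x" for x using 1 2 by (simp add: a_def)
  have s1: "sum a (X1 \<inter> D) = sum a1 (X1 \<inter> D)" for D
    by (rule sum.cong) (use 1(2) in \<open>auto simp: a_def\<close>)
  have s2: "sum a (X2 \<inter> D) = sum a2 (X2 \<inter> D)" for D
    by (rule sum.cong) (use 2(2) disj in \<open>auto simp: a_def\<close>)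
  have X: "finite ?X" "?X \<subseteq> A \<inter> dyadic n k"
    using 1 2 by (auto simp: dyadic_Suc[of n k])
  have tot: "sum a ?X = sum a1 X1 + sum a2 X2"
    using s1[of UNIV] s2[of UNIV] 1(1,2) 2(1,2) disj
    by (subst sum.union_disjoint) auto
  \<comment> \<open>A dyadic interval strictly below the node misses one of the two halves, so the
    bound for the other half carries over.\<close>
  have deep: "sum a (?X \<inter> dyadic n' k') \<le> (1/2) powr (s * n')" if "Suc n \<le> n'" "n' \<le> N" for n' k'
  proof -
    have "dyadic n' k' \<inter> ?L = {} \<or> dyadic n' k' \<inter> ?R = {}"
      using dyadic_subset_or_disjoint[OF that(1), of k' "2 * k"] disj by auto
    then have "?X \<inter> dyadic n' k' = X2 \<inter> dyadic n' k' \<or> ?X \<inter> dyadic n' k' = X1 \<inter> dyadic n' k'"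
      using 1(2) 2(2) by blast
    then show ?thesis using 1(4)[OF that] 2(4)[OF that] s1 s2 by auto
  qed
  show ?case
  proof (cases "sum a ?X \<le> (1/2) powr (s * n)")
    case True
    have "sum a (?X \<inter> dyadic n' k') \<le> (1/2) powr (s * n')" if "n \<le> n'" "n' \<le> N" for n' k'
    proof (cases "n' = n")
      case n': True
      have "sum a (?X \<inter> dyadic n' k') \<le> sum a ?X" by (intro sum_mono2 X) (auto simp: a0)
      then show ?thesis using True n' by simp
    qed (use deep that in auto)
    moreover have "A \<inter> dyadic n k \<subseteq> (\<Union>(n', k')\<in>J1 \<union> J2. dyadic n' k')"
      using 1(6) 2(6) dyadic_Suc[of n k] by blast
    moreover have "(\<Sum>(n', k')\<in>J1 \<union> J2. (1/2) powr (s * real n')) \<le> sum a ?X"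
    proof -
      have "(\<Sum>(n', k')\<in>J1 \<union> J2. (1/2) powr (s * real n'))
          \<le> (\<Sum>(n', k')\<in>J1. (1/2) powr (s * real n')) + (\<Sum>(n', k')\<in>J2. (1/2) powr (s * real n'))"
        using 1(5) 2(5) by (subst sum_Un) (auto intro!: sum_nonneg)
      then show ?thesis using 1(7) 2(7) tot by simp
    qed
    ultimately show ?thesis
      using X a0 1(5) 2(5) unfolding tree_measure_def
      by (intro exI[of _ ?X] exI[of _ a] exI[of _ "J1 \<union> J2"]) blast
  next
    case False
    define c where "c = (1/2) powr (s * n) / sum a ?X"
    have pos: "0 < sum a ?X" using False by (smt (verit) powr_ge_zero)
    have c: "0 \<le> c" "c \<le> 1" "c * sum a ?X = (1/2) powr (s * n)"
      using False pos by (auto simp: c_def)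
    have sc: "(\<Sum>x\<in>S. c * a x) = c * sum a S" for S by (simp add: sum_distrib_left)
    have "(\<Sum>x\<in>?X \<inter> dyadic n' k'. c * a x) \<le> (1/2) powr (s * n')" if "n \<le> n'" "n' \<le> N" for n' k'
    proof (cases "n' = n")
      case n': True
      have "sum a (?X \<inter> dyadic n' k') \<le> sum a ?X" by (intro sum_mono2 X) (auto simp: a0)
      then show ?thesis using c n' sc by (metis mult_left_mono)
    next
      case False
      have "c * sum a (?X \<inter> dyadic n' k') \<le> 1 * sum a (?X \<inter> dyadic n' k')"
        by (intro mult_right_mono c sum_nonneg a0)
      also have "\<dots> \<le> (1/2) powr (s * n')" using deep[of n' k'] False that by simp
      finally show ?thesis by (simp add: sc)
    qed
    then show ?thesis
      using X a0 c unfolding tree_measure_def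
      by (intro exI[of _ ?X] exI[of _ "\<lambda>x. c * a x"] exI[of _ "{(n, k)}"]) (auto simp: sc)
  qed
qed

text \<open>Weights on the separate unit intervals are put together. Their certificates jointly
  cover \<open>A\<close>, so the assumption on covers bounds the total mass from below; each of the
  \<open>2 * B\<close> unit intervals carries mass at most 1.\<close>

lemma discrete_frostman:
  assumes bnd: "\<And>x. x \<in> A \<Longrightarrow> \<bar>x\<bar> < real B"
    and cover: "\<And>J. finite J \<Longrightarrow> A \<subseteq> (\<Union>(n', k')\<in>J. dyadic n' k') \<Longrightarrow>
      c \<le> (\<Sum>(n', k')\<in>J. (1/2) powr (s * real n'))"
  obtains X a where "finite X" "X \<subseteq> A" "\<And>x. 0 \<le> (a x :: real)" "c \<le> sum a X" "sum a X \<le> 2 * B"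
    "\<And>n k. n \<le> N \<Longrightarrow> sum a (X \<inter> dyadic n k) \<le> (1/2) powr (s * n)"
proof -
  have "\<forall>k. \<exists>X a J. tree_measure s N A 0 k X a J"
    using ex_tree_measure[of 0 N N] by simp
  then obtain X a J where "\<And>k. tree_measure s N A 0 k (X k) (a k) (J k)"
    by metis
  note XaJ = tree_measureD[OF this]
  define I where "I = {- int B ..< int B}"
  define b where "b x = a \<lfloor>x\<rfloor> x" for x
  let ?X = "\<Union>k\<in>I. X k"
  have fl: "\<lfloor>x\<rfloor> = k" if "x \<in> X k" for x k using XaJ(2)[of k] that by (auto simp: dyadic_def)
  have inI: "\<lfloor>x\<rfloor> \<in> I" if "x \<in> A" for x
    using bnd[OF that] unfolding I_def by (simp add: le_floor_iff floor_less_iff) linarith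
  have b: "sum b (X k \<inter> D) = sum (a k) (X k \<inter> D)" for k D
    by (rule sum.cong) (auto simp: b_def fl)
  have total: "sum b ?X = (\<Sum>k\<in>I. sum (a k) (X k))"
    using b[of _ UNIV] XaJ(1) by (subst sum.UNION_disjoint) (auto simp: I_def dest!: fl)
  show ?thesis
  proof
    show "finite ?X" using XaJ(1) by (auto simp: I_def)
    show "?X \<subseteq> A" using XaJ(2) by blast
    show "0 \<le> b x" for x using XaJ(3) by (simp add: b_def)
    show "c \<le> sum b ?X"
    proof -
      have "c \<le> (\<Sum>(n', k')\<in>(\<Union>k\<in>I. J k). (1/2) powr (s * real n'))"
      proof (rule cover)
        show "finite (\<Union>k\<in>I. J k)" using XaJ(5) by (auto simp: I_def)
        show "A \<subseteq> (\<Union>(n', k')\<in>(\<Union>k\<in>I. J k). dyadic n' k')"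
        proof
          fix x assume x: "x \<in> A"
          then have "x \<in> A \<inter> dyadic 0 \<lfloor>x\<rfloor>" by (simp add: dyadic_def)
          with XaJ(6)[of "\<lfloor>x\<rfloor>"] inI[OF x] show "x \<in> (\<Union>(n', k')\<in>(\<Union>k\<in>I. J k). dyadic n' k')" by blast
        qed
      qed
      also have "\<dots> \<le> (\<Sum>k\<in>I. \<Sum>(n', k')\<in>J k. (1/2) powr (s * real n'))"
        using XaJ(5) by (intro sum_UN_le) (auto simp: I_def)
      also have "\<dots> \<le> (\<Sum>k\<in>I. sum (a k) (X k))" by (intro sum_mono XaJ(7))
      finally show ?thesis by (simp add: total)
    qed
    show "sum b ?X \<le> 2 * B"
    proof -
      have "sum (a k) (X k) \<le> 1" for k
      proof -
        have "X k \<inter> dyadic 0 k = X k" using XaJ(2)[of k] by auto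
        then show ?thesis using XaJ(4)[of 0 k k] by simp
      qed
      then have "(\<Sum>k\<in>I. sum (a k) (X k)) \<le> (\<Sum>k\<in>I. 1)" by (intro sum_mono)
      then show ?thesis unfolding total by (simp add: I_def)
    qed
    show "sum b (?X \<inter> dyadic n k) \<le> (1/2) powr (s * n)" if "n \<le> N" for n k
    proof -
      \<comment> \<open>A dyadic interval lies in a single unit interval, so at most one
        \<open>X j\<close> contributes.\<close>
      obtain j where j: "dyadic n k \<inter> X i = {}" if "i \<noteq> j" for i
      proof (cases "\<exists>x j. x \<in> X j \<and> x \<in> dyadic n k")
        case True
        then obtain x j where x: "x \<in> X j" "x \<in> dyadic n k" by auto
        then have "dyadic n k \<subseteq> dyadic 0 j"
          using dyadic_subset_or_disjoint[of 0 n k j] XaJ(2)[of j] by auto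
        then have "dyadic n k \<inter> X i = {}" if "i \<noteq> j" for i
          using XaJ(2)[of i] that by (auto simp: dyadic_def)
        with that show ?thesis by blast
      qed (use that in auto)
      have "sum b (?X \<inter> dyadic n k) \<le> sum b (X j \<inter> dyadic n k)"
      proof (rule sum_mono2)
        show "?X \<inter> dyadic n k \<subseteq> X j \<inter> dyadic n k"
        proof safe
          fix x i assume "x \<in> dyadic n k" "x \<in> X i"
          then show "x \<in> X j" using j[of i] by (cases "i = j") auto
        qed
      qed (use XaJ(1,3) in \<open>auto simp: b_def\<close>)
      also have "\<dots> \<le> (1/2) powr (s * n)" using b XaJ(4)[of n j k] that by simp
      finally show ?thesis .
    qed
  qed
qed

text \<open>At the level \<open>n\<close> with \<open>2 ^ n * r \<le> 1 < 2 ^ Suc n * r\<close>, a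
  ball of radius \<open>r\<close> meets at most three cells, each shorter than \<open>2 * r\<close>;
  this gives \<open>3 * 2 powr s\<close>.\<close>

lemma frostman_ball:
  fixes s y r :: real
  assumes X: "finite X" and a: "\<And>x. 0 \<le> (a x :: real)"
    and dy: "\<And>n k. n \<le> N \<Longrightarrow> sum a (X \<inter> dyadic n k) \<le> (1/2) powr (s * n)"
    and r: "1 / 2 ^ N \<le> r" "r \<le> 1" and s: "0 \<le> s"
  shows "(\<Sum>x | x \<in> X \<and> \<bar>x - y\<bar> \<le> r. a x) \<le> 3 * 2 powr s * r powr s"
proof -
  have "0 < r" using r by (smt (verit) divide_pos_pos zero_less_power)
  define n where "n = nat \<lfloor>log 2 (1 / r)\<rfloor>"
  have "0 \<le> log 2 (1 / r)" using r \<open>0 < r\<close> by simp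
  then have nl: "real n \<le> log 2 (1 / r)" "log 2 (1 / r) < real n + 1" unfolding n_def by linarith+
  have rn: "2 ^ n * r \<le> 1" "1 < 2 ^ Suc n * r"
  proof -
    have "2 powr real n \<le> 1 / r" using nl \<open>0 < r\<close> by (simp add: le_log_iff)
    then show "2 ^ n * r \<le> 1" using \<open>0 < r\<close> by (simp add: powr_realpow field_simps)
    have "1 / r < 2 powr real (Suc n)" using nl \<open>0 < r\<close> by (simp add: log_less_iff add.commute)
    then show "1 < 2 ^ Suc n * r" using \<open>0 < r\<close> by (simp only: powr_realpow) (simp add: field_simps)
  qed
  have "n \<le> N"
  proof (rule ccontr)
    assume "\<not> n \<le> N"
    then have "(2::real) ^ N < 2 ^ n" by simp
    then have "2 ^ N * r < 2 ^ n * r" using \<open>0 < r\<close> by simp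
    moreover have "1 \<le> 2 ^ N * r" using r by (simp add: field_simps)
    ultimately show False using rn by linarith
  qed
  define p where "p = \<lfloor>y * 2 ^ n\<rfloor>"
  have sub: "{x \<in> X. \<bar>x - y\<bar> \<le> r} \<subseteq> (\<Union>q\<in>{p - 1..p + 1}. X \<inter> dyadic n q)"
  proof safe
    fix x assume x: "x \<in> X" "\<bar>x - y\<bar> \<le> r"
    have "\<bar>x * 2 ^ n - y * 2 ^ n\<bar> = \<bar>x - y\<bar> * 2 ^ n" by (simp add: abs_mult flip: left_diff_distrib)
    also have "\<dots> \<le> r * 2 ^ n" using x by (intro mult_right_mono) auto
    also have "\<dots> \<le> 1" using rn by (simp add: mult.commute)
    finally have "\<lfloor>x * 2 ^ n\<rfloor> \<in> {p - 1..p + 1}" unfolding p_def by (simp, linarith)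
    then show "x \<in> (\<Union>q\<in>{p - 1..p + 1}. X \<inter> dyadic n q)" using x by (auto simp: dyadic_def)
  qed
  have "(\<Sum>x | x \<in> X \<and> \<bar>x - y\<bar> \<le> r. a x) \<le> sum a (\<Union>q\<in>{p - 1..p + 1}. X \<inter> dyadic n q)"
    by (rule sum_mono2[OF _ sub]) (use X a in auto)
  also have "\<dots> \<le> (\<Sum>q\<in>{p - 1..p + 1}. sum a (X \<inter> dyadic n q))"
    using X a by (intro sum_UN_le) auto
  also have "\<dots> \<le> (\<Sum>q\<in>{p - 1..p + 1}. (1/2) powr (s * n))"
    by (intro sum_mono dy \<open>n \<le> N\<close>)
  also have "\<dots> = 3 * (1/2) powr (n * s)" by (simp add: mult.commute)
  also have "(1/2) powr (n * s) = (1 / 2 ^ n) powr s"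
    by (simp add: powr_realpow power_one_over flip: powr_powr)
  also have "\<dots> \<le> (2 * r) powr s"
    using rn s by (intro powr_mono2) (auto simp: field_simps)
  finally show ?thesis using \<open>0 < r\<close> by (simp add: powr_mult)
qed

section \<open>Hausdorff dimension and dyadic covers\<close>

lemma hausdorff_dim_cover:
  fixes A :: "real set"
  assumes dim: "ennreal s < hausdorff_dim A" and s: "0 < s"
  obtains c where "0 < c" "\<And>J. finite J \<Longrightarrow> A \<subseteq> (\<Union>(n', k')\<in>J. dyadic n' k') \<Longrightarrow>
      c \<le> (\<Sum>(n', k')\<in>J. (1/2) powr (s * real n'))"
proof -
  have "hausdorff_measure s A \<noteq> 0"
  proof
    assume "hausdorff_measure s A = 0"
    then have "hausdorff_dim A \<le> ennreal s"
      unfolding hausdorff_dim_def by (intro INF_lower) (use s in auto)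
    with dim show False by simp
  qed
  then obtain \<delta> where \<delta>: "0 < \<delta>" "hausdorff_content s \<delta> A \<noteq> 0"
    unfolding hausdorff_measure_def by (force simp: SUP_eq_iff intro: antisym)
  \<comment> \<open>The content may be infinite; truncation at 1 yields a positive real lower
    bound.\<close>
  define e where "e = enn2real (min (hausdorff_content s \<delta> A) 1)"
  have e: "0 < e" "ennreal e \<le> hausdorff_content s \<delta> A"
  proof -
    have lt: "min (hausdorff_content s \<delta> A) 1 < top" by (simp add: min_less_iff_disj)
    then show "0 < e" using \<delta>(2) by (auto simp: e_def enn2real_positive_iff zero_less_iff_neq_zero min_def)
    have "ennreal e = min (hausdorff_content s \<delta> A) 1" using lt by (simp add: e_def)
    then show "ennreal e \<le> hausdorff_content s \<delta> A" by simp
  qed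
  have diam: "bounded (dyadic n k)" "diameter (dyadic n k) \<le> (1/2) ^ n" for n k
  proof -
    show "bounded (dyadic n k)" unfolding dyadic_eq_interval
      by (rule bounded_subset[OF bounded_closed_interval[of "real_of_int k / 2 ^ n" "(real_of_int k + 1) / 2 ^ n"]]) auto
    have "dist x y \<le> (1/2) ^ n" if "x \<in> dyadic n k" "y \<in> dyadic n k" for x y
      using that unfolding dyadic_eq_interval dist_real_def
      by (auto simp: add_divide_distrib power_one_over abs_le_iff)
    then show "diameter (dyadic n k) \<le> (1/2) ^ n" by (intro diameter_le) (auto simp: dist_norm)
  qed
  show ?thesis
  proof
    \<comment> \<open>If all cells have length at most \<open>\<delta>\<close>, the cover is
      admissible for the content and costs at least \<open>e\<close>; otherwise one long cell alone
      costs at least \<open>\<delta> powr s\<close>.\<close>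
    show "0 < min e (\<delta> powr s)" using e \<delta> by simp
    fix J :: "(nat \<times> int) set"
    assume J: "finite J" "A \<subseteq> (\<Union>(n', k')\<in>J. dyadic n' k')"
    let ?S = "\<Sum>(n', k')\<in>J. (1/2) powr (s * real n')"
    have pw: "(1/2) powr (s * real n') = ((1/2) ^ n') powr s" for n'
      by (simp add: powr_powr mult.commute flip: powr_realpow)
    show "min e (\<delta> powr s) \<le> ?S"
    proof (cases "\<forall>(n', k')\<in>J. (1/2) ^ n' \<le> \<delta>")
      case False
      then obtain n' k' where nk: "(n', k') \<in> J" "\<delta> < (1/2) ^ n'" by auto
      have "\<delta> powr s \<le> ((1/2) ^ n') powr s" using nk \<delta> s by (intro powr_mono2) auto
      also have "\<dots> = (\<Sum>(n', k')\<in>{(n', k')}. (1/2) powr (s * real n'))" by (simp add: pw)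
      also have "\<dots> \<le> ?S" using nk J by (intro sum_mono2) auto
      finally show ?thesis by simp
    next
      case True
      obtain g where g: "bij_betw g {0..<card J} J" using J(1) ex_bij_betw_nat_finite by blast
      \<comment> \<open>The finite cover is padded to a sequence by empty sets, which
        \<open>diam_pow\<close> counts as 0.\<close>
      define U where "U i = (if i < card J then (case g i of (n', k') \<Rightarrow> dyadic n' k') else {})" for i
      have gJ: "g i \<in> J" if "i < card J" for i using g that by (auto simp: bij_betw_def)
      have "A \<subseteq> (\<Union>i. U i)"
      proof
        fix x assume "x \<in> A"
        then obtain n' k' where nk: "(n', k') \<in> J" "x \<in> dyadic n' k'" using J by auto
        then have "(n', k') \<in> g ` {0..<card J}" using g by (simp add: bij_betw_def)
        then obtain i where "i < card J" "g i = (n', k')" by (metis imageE atLeastLessThan_iff)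
        then show "x \<in> (\<Union>i. U i)" using nk by (auto simp: U_def intro!: exI[of _ i])
      qed
      moreover have "bounded (U i) \<and> diameter (U i) \<le> \<delta>" for i
      proof (cases "i < card J")
        case i: True
        obtain n' k' where nk: "g i = (n', k')" by force
        then have "(1/2) ^ n' \<le> \<delta>" using gJ[OF i] True by auto
        then show ?thesis using diam[of n' k'] nk i by (auto simp: U_def)
      qed (use \<delta> in \<open>auto simp: U_def\<close>)
      ultimately have "hausdorff_content s \<delta> A \<le> suminf (\<lambda>i. diam_pow s (U i))"
        unfolding hausdorff_content_def by (intro INF_lower) auto
      also have "\<dots> = (\<Sum>i\<in>{0..<card J}. diam_pow s (U i))"
        by (rule suminf_finite) (auto simp: U_def diam_pow_def)
      also have "\<dots> \<le> (\<Sum>i\<in>{0..<card J}. ennreal (case g i of (n', k') \<Rightarrow> (1/2) powr (s * real n')))"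
      proof (intro sum_mono)
        fix i assume i: "i \<in> {0..<card J}"
        obtain n' k' where nk: "g i = (n', k')" by force
        have "diam_pow s (U i) \<le> ennreal (diameter (U i) powr s)"
          using s by (auto simp: diam_pow_def)
        also have "\<dots> \<le> ennreal ((1/2) powr (s * real n'))"
          unfolding pw using diam[of n' k'] nk i s
          by (intro ennreal_leI powr_mono2) (auto simp: U_def intro: diameter_ge_0)
        finally show "diam_pow s (U i) \<le> ennreal (case g i of (n', k') \<Rightarrow> (1/2) powr (s * real n'))"
          by (simp add: nk)
      qed
      also have "\<dots> = ennreal (\<Sum>i\<in>{0..<card J}. (case g i of (n', k') \<Rightarrow> (1/2) powr (s * real n')))"
        by (intro sum_ennreal) (auto split: prod.split)
      also have "(\<Sum>i\<in>{0..<card J}. (case g i of (n', k') \<Rightarrow> (1/2) powr (s * real n'))) = ?S"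
        by (rule sum.reindex_bij_betw[OF g])
      finally have "ennreal e \<le> ennreal ?S" using e by simp
      moreover have "0 \<le> ?S" by (auto intro!: sum_nonneg)
      ultimately have "e \<le> ?S" by simp
      then show ?thesis by simp
    qed
  qed
qed

text \<open>For \<open>s > 1\<close> the cover of \<open>A\<close> by level-\<open>n\<close> cells
  costs \<open>2 * B * (2 powr (1 - s)) ^ n\<close>, which tends to 0 and contradicts
  \<open>hausdorff_dim_cover\<close>.\<close>

lemma hausdorff_dim_le_1:
  fixes A :: "real set"
  assumes "bounded A"
  shows "hausdorff_dim A \<le> 1"
proof (rule ccontr)
  assume "\<not> hausdorff_dim A \<le> 1"
  then have "1 < hausdorff_dim A" by simp
  then obtain t where t: "1 < t" "t < hausdorff_dim A" using dense by blast
  then obtain s where s: "t = ennreal s" "0 \<le> s" by (cases t) auto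
  then have s1: "1 < s" using t by simp
  obtain c where c: "0 < c" "\<And>J. finite J \<Longrightarrow> A \<subseteq> (\<Union>(n', k')\<in>J. dyadic n' k') \<Longrightarrow>
      c \<le> (\<Sum>(n', k')\<in>J. (1/2) powr (s * real n'))"
    using hausdorff_dim_cover[of s A] t s s1 by auto
  obtain b where b: "\<And>x. x \<in> A \<Longrightarrow> \<bar>x\<bar> \<le> b" using assms by (auto simp: bounded_iff)
  define B where "B = nat \<lceil>b\<rceil> + 1"
  have B: "\<bar>x\<bar> < real B" if "x \<in> A" for x using b[OF that] unfolding B_def by linarith
  have est: "c \<le> 2 * B * (2 powr (1 - s)) ^ n" for n
  proof -
    let ?I = "{- (int B * 2 ^ n)..<int B * 2 ^ n}"
    let ?J = "Pair n ` ?I"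
    have "A \<subseteq> (\<Union>(n', k')\<in>?J. dyadic n' k')"
    proof
      fix x assume "x \<in> A"
      then have "- real B * 2 ^ n \<le> x * 2 ^ n" "x * 2 ^ n < real B * 2 ^ n"
        using B[of x] by (intro mult_right_mono mult_strict_right_mono; force)+
      then have "\<lfloor>x * 2 ^ n\<rfloor> \<in> ?I" by (simp add: le_floor_iff floor_less_iff)
      then show "x \<in> (\<Union>(n', k')\<in>?J. dyadic n' k')" by (auto simp: dyadic_def)
    qed
    then have "c \<le> (\<Sum>(n', k')\<in>?J. (1/2) powr (s * real n'))" by (intro c) auto
    also have "\<dots> = (\<Sum>k\<in>?I. (1/2) powr (s * real n))" by (subst sum.reindex) (auto simp: inj_on_def)
    also have "\<dots> = 2 * B * (2 ^ n * (1/2) powr (s * real n))" by simp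
    also have "2 ^ n * (1/2) powr (s * real n) = (2 powr (1 - s)) ^ n"
    proof -
      have "2 ^ n * (1/2::real) powr (s * real n) = 2 powr n * 2 powr (- (s * n))"
        by (simp add: powr_realpow powr_minus powr_divide inverse_eq_divide)
      also have "\<dots> = 2 powr ((1 - s) * n)" by (simp add: algebra_simps flip: powr_add)
      also have "\<dots> = (2 powr (1 - s)) ^ n" by (simp add: powr_realpow flip: powr_powr)
      finally show ?thesis .
    qed
    finally show ?thesis .
  qed
  have "2 powr (1 - s) < 1" using s1 powr_less_mono[of "1 - s" 0 2] by simp
  then have "(\<lambda>n. 2 * real B * (2 powr (1 - s)) ^ n) \<longlonglongrightarrow> 2 * real B * 0"
    by (intro tendsto_mult_left LIMSEQ_realpow_zero) auto
  then have "c \<le> 0" using est by (intro LIMSEQ_le_const) auto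
  with c show False by simp
qed

section \<open>Product weights under a quadratic map\<close>

text \<open>The finite substitute for a Frostman measure, resolved down to scale
  \<open>1 / 2 ^ N\<close>; a single \<open>T\<close> serves both upper bounds so that fewer
  constants are carried along.\<close>

definition frostman_weight :: "real \<Rightarrow> real \<Rightarrow> real \<Rightarrow> nat \<Rightarrow> real set \<Rightarrow> (real \<Rightarrow> real) \<Rightarrow> bool" where
  "frostman_weight s c T N X a \<longleftrightarrow> finite X \<and> (\<forall>x. 0 \<le> a x) \<and> c \<le> sum a X \<and> sum a X \<le> T \<and>
    (\<forall>y r. 1 / 2 ^ N \<le> r \<longrightarrow> r \<le> 1 \<longrightarrow> (\<Sum>x | x \<in> X \<and> \<bar>x - y\<bar> \<le> r. a x) \<le> T * r powr s)"

lemma frostman_weightD: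
  assumes "frostman_weight s c T N X a"
  shows "finite X" "\<And>x. 0 \<le> a x" "c \<le> sum a X" "sum a X \<le> T"
    "\<And>y r. 1 / 2 ^ N \<le> r \<Longrightarrow> r \<le> 1 \<Longrightarrow> (\<Sum>x | x \<in> X \<and> \<bar>x - y\<bar> \<le> r. a x) \<le> T * r powr s"
  using assms unfolding frostman_weight_def by blast+

text \<open>Here \<open>c\<close> and \<open>T\<close> are fixed before \<open>N\<close>; this
  uniformity takes the place of a limit measure.\<close>

lemma ex_frostman_weight:
  fixes A :: "real set"
  assumes "bounded A" "0 < s" "ennreal s < hausdorff_dim A"
  obtains c T where "0 < c" "0 < T" "\<And>N. \<exists>X a. X \<subseteq> A \<and> frostman_weight s c T N X a"
proof -
  obtain c where c: "0 < c" "\<And>J. finite J \<Longrightarrow> A \<subseteq> (\<Union>(n', k')\<in>J. dyadic n' k') \<Longrightarrow>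
      c \<le> (\<Sum>(n', k')\<in>J. (1/2) powr (s * real n'))"
    using hausdorff_dim_cover assms(2,3) by blast
  obtain b where b: "\<And>x. x \<in> A \<Longrightarrow> \<bar>x\<bar> \<le> b" using assms(1) by (auto simp: bounded_iff)
  define B where "B = nat \<lceil>b\<rceil> + 1"
  have B: "\<bar>x\<bar> < real B" if "x \<in> A" for x using b[OF that] unfolding B_def by linarith
  define T where "T = max (2 * B) (3 * 2 powr s)"
  show ?thesis
  proof
    show "0 < c" by fact
    show "0 < T" unfolding T_def by (simp add: less_max_iff_disj)
    fix N
    obtain X a where X: "finite X" "X \<subseteq> A" "\<And>x. 0 \<le> (a x :: real)" "c \<le> sum a X" "sum a X \<le> 2 * B"
      "\<And>n k. n \<le> N \<Longrightarrow> sum a (X \<inter> dyadic n k) \<le> (1/2) powr (s * n)"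
      using discrete_frostman[OF B c(2)] by blast
    have "(\<Sum>x | x \<in> X \<and> \<bar>x - y\<bar> \<le> r. a x) \<le> T * r powr s" if "1 / 2 ^ N \<le> r" "r \<le> 1" for y r
    proof -
      have "(\<Sum>x | x \<in> X \<and> \<bar>x - y\<bar> \<le> r. a x) \<le> 3 * 2 powr s * r powr s"
        by (rule frostman_ball[OF X(1,3,6) that]) (use assms in auto)
      also have "\<dots> \<le> T * r powr s" unfolding T_def by (intro mult_right_mono) auto
      finally show ?thesis .
    qed
    then show "\<exists>X a. X \<subseteq> A \<and> frostman_weight s c T N X a"
      using X unfolding frostman_weight_def T_def by (intro exI[of _ X] exI[of _ a]) auto
  qed
qed

text \<open>For each fixed \<open>z\<close> the strip cuts out an interval of radius
  \<open>\<rho>\<close> in \<open>y\<close>, which by the choice of \<open>\<rho>\<close> carries at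
  most half the mass of \<open>b\<close>.\<close>

lemma frostman_strip:
  assumes Y: "frostman_weight s c T N Y b" and Z: "finite Z" "\<And>z. 0 \<le> c' z"
    and j: "j1 \<noteq> 0" and \<rho>: "1 / 2 ^ N \<le> \<rho>" "\<rho> \<le> 1" "T * \<rho> powr s \<le> c / 2"
  shows "(\<Sum>z\<in>Z. \<Sum>y\<in>Y. if \<bar>j1 * y + j2 * z + j0\<bar> \<le> \<rho> * \<bar>j1\<bar> then b y * c' z else 0)
    \<le> (sum b Y * sum c' Z) / 2"
proof -
  note Y = frostman_weightD[OF Y]
  have "(\<Sum>y\<in>Y. if \<bar>j1 * y + j2 * z + j0\<bar> \<le> \<rho> * \<bar>j1\<bar> then b y * c' z else 0) \<le> (sum b Y / 2) * c' z" for z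
  proof -
    define y0 where "y0 = - (j2 * z + j0) / j1"
    have "\<bar>j1 * y + j2 * z + j0\<bar> = \<bar>y - y0\<bar> * \<bar>j1\<bar>" for y
      using j by (simp add: y0_def abs_mult[symmetric] field_simps)
    then have "(\<Sum>y\<in>Y. if \<bar>j1 * y + j2 * z + j0\<bar> \<le> \<rho> * \<bar>j1\<bar> then b y * c' z else 0)
        = (\<Sum>y\<in>Y. if \<bar>y - y0\<bar> \<le> \<rho> then b y else 0) * c' z"
      using j unfolding sum_distrib_right by (intro sum.cong) auto
    also have "(\<Sum>y\<in>Y. if \<bar>y - y0\<bar> \<le> \<rho> then b y else 0) = (\<Sum>y | y \<in> Y \<and> \<bar>y - y0\<bar> \<le> \<rho>. b y)"
      using Y(1) by (simp add: sum.inter_filter)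
    also have "\<dots> \<le> sum b Y / 2"
      using Y(5)[OF \<rho>(1,2), of y0] \<rho>(3) Y(3) by linarith
    finally show ?thesis using Z(2)[of z] by (simp add: mult_right_mono)
  qed
  then have "(\<Sum>z\<in>Z. \<Sum>y\<in>Y. if \<bar>j1 * y + j2 * z + j0\<bar> \<le> \<rho> * \<bar>j1\<bar> then b y * c' z else 0)
      \<le> (\<Sum>z\<in>Z. (sum b Y / 2) * c' z)" by (intro sum_mono)
  also have "\<dots> = (sum b Y / 2) * sum c' Z" by (simp only: sum_distrib_left)
  finally show ?thesis by simp
qed

lemma ex_small_powr:
  assumes "0 < (s::real)" "0 < e" "0 < T"
  obtains \<rho> where "0 < \<rho>" "\<rho> \<le> 1" "T * \<rho> powr s \<le> e"
proof
  let ?\<rho> = "min 1 ((e / T) powr (1 / s))"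
  show "0 < ?\<rho>" "?\<rho> \<le> 1" using assms by auto
  have "?\<rho> powr s \<le> ((e / T) powr (1 / s)) powr s" using assms by (intro powr_mono2) auto
  also have "\<dots> = e / T" using assms by (simp add: powr_powr)
  finally show "T * ?\<rho> powr s \<le> e" using assms by (simp add: field_simps)
qed

text \<open>The affine function stands for the Jacobian of \<open>(y, z) \<mapsto> (v, w)\<close>. A
  thin strip around its zero line carries at most half of the product mass, and one of the two signs
  outside keeps a quarter. A fixed sign is required because the expansion argument adds the
  Jacobians at two points.\<close>

lemma ex_nondegenerate_part:
  assumes \<beta>: "0 < \<beta>" "0 < cB" "0 < TB" and \<gamma>: "0 < \<gamma>" "0 < cC" "0 < TC"
    and J: "(j0, j1, j2) \<noteq> (0::real, 0::real, 0::real)"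
  obtains \<epsilon> N0 where "0 < \<epsilon>"
    "\<And>N Y b Z c. N0 \<le> N \<Longrightarrow> frostman_weight \<beta> cB TB N Y b \<Longrightarrow> frostman_weight \<gamma> cC TC N Z c \<Longrightarrow>
       \<exists>\<sigma>\<in>{1, -1}. cB * cC / 4 \<le> (\<Sum>(y, z) | y \<in> Y \<and> z \<in> Z \<and> \<epsilon> < \<sigma> * (j1 * y + j2 * z + j0). b y * c z)"
proof -
  let ?strip = "\<lambda>\<epsilon> Y b Z c. \<Sum>z\<in>Z. \<Sum>y\<in>Y. if \<bar>j1 * y + j2 * z + j0\<bar> \<le> \<epsilon> then b y * c z else (0::real)"
  have "\<exists>\<epsilon> N0. 0 < \<epsilon> \<and> (\<forall>N Y b Z c. N0 \<le> N \<longrightarrow> frostman_weight \<beta> cB TB N Y b \<longrightarrow> frostman_weight \<gamma> cC TC N Z c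
      \<longrightarrow> ?strip \<epsilon> Y b Z c \<le> (sum b Y * sum c Z) / 2)"
  proof -
    \<comment> \<open>The strip is sliced in \<open>y\<close> or in \<open>z\<close> according to
      which coefficient is nonzero; a nonzero constant Jacobian leaves it empty.\<close>
    consider "j1 \<noteq> 0" | "j1 = 0" "j2 \<noteq> 0" | "j1 = 0" "j2 = 0" "j0 \<noteq> 0" using J by auto
    then show ?thesis
    proof cases
      case 1
      obtain \<rho> where \<rho>: "0 < \<rho>" "\<rho> \<le> 1" "TB * \<rho> powr \<beta> \<le> cB / 2"
        using ex_small_powr[of \<beta> "cB / 2" TB] \<beta> by auto
      obtain N0 where N0: "(1 / 2) ^ N0 < \<rho>" using real_arch_pow_inv[of \<rho> "1/2"] \<rho> by auto
      have le: "1 / 2 ^ N \<le> \<rho>" if "N0 \<le> N" for N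
        using power_decreasing[OF that, of "1/2::real"] N0 by (simp add: power_one_over)
      have "?strip (\<rho> * \<bar>j1\<bar>) Y b Z c \<le> (sum b Y * sum c Z) / 2"
        if "N0 \<le> N" "frostman_weight \<beta> cB TB N Y b" "frostman_weight \<gamma> cC TC N Z c" for N Y b Z c
        by (rule frostman_strip[OF that(2)]) (use 1 \<rho> le[OF that(1)] frostman_weightD[OF that(3)] in auto)
      then show ?thesis using \<rho> 1 by (intro exI[of _ "\<rho> * \<bar>j1\<bar>"] exI[of _ N0]) auto
    next
      case 2
      obtain \<rho> where \<rho>: "0 < \<rho>" "\<rho> \<le> 1" "TC * \<rho> powr \<gamma> \<le> cC / 2"
        using ex_small_powr[of \<gamma> "cC / 2" TC] \<gamma> by auto
      obtain N0 where N0: "(1 / 2) ^ N0 < \<rho>" using real_arch_pow_inv[of \<rho> "1/2"] \<rho> by auto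
      have le: "1 / 2 ^ N \<le> \<rho>" if "N0 \<le> N" for N
        using power_decreasing[OF that, of "1/2::real"] N0 by (simp add: power_one_over)
      have "?strip (\<rho> * \<bar>j2\<bar>) Y b Z c \<le> (sum b Y * sum c Z) / 2"
        if "N0 \<le> N" "frostman_weight \<beta> cB TB N Y b" "frostman_weight \<gamma> cC TC N Z c" for N Y b Z c
      proof -
        have "?strip (\<rho> * \<bar>j2\<bar>) Y b Z c
          = (\<Sum>y\<in>Y. \<Sum>z\<in>Z. if \<bar>j2 * z + j1 * y + j0\<bar> \<le> \<rho> * \<bar>j2\<bar> then c z * b y else 0)"
        proof -
          have "(if \<bar>j1 * y + j2 * z + j0\<bar> \<le> e then b y * c z else 0)
              = (if \<bar>j2 * z + j1 * y + j0\<bar> \<le> e then c z * b y else 0)" for y z e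
            by (simp add: mult.commute[of "b y"] add.commute[of "j1 * y"])
          then show ?thesis by (subst sum.swap) (simp only:)
        qed
        also have "\<dots> \<le> (sum c Z * sum b Y) / 2"
          by (rule frostman_strip[OF that(3)]) (use 2 \<rho> le[OF that(1)] frostman_weightD[OF that(2)] in auto)
        finally show ?thesis by (simp add: mult.commute)
      qed
      then show ?thesis using \<rho> 2 by (intro exI[of _ "\<rho> * \<bar>j2\<bar>"] exI[of _ N0]) auto
    next
      case 3
      have "?strip (\<bar>j0\<bar> / 2) Y b Z c \<le> (sum b Y * sum c Z) / 2"
        if "frostman_weight \<beta> cB TB N Y b" "frostman_weight \<gamma> cC TC N Z c" for N Y b Z c
        using 3 frostman_weightD[OF that(1)] frostman_weightD[OF that(2)] by (simp add: sum_nonneg)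
      then show ?thesis using 3 by (intro exI[of _ "\<bar>j0\<bar> / 2"] exI[of _ 0]) auto
    qed
  qed
  then obtain \<epsilon> N0 where \<epsilon>: "0 < \<epsilon>" "\<And>N Y b Z c. N0 \<le> N \<Longrightarrow> frostman_weight \<beta> cB TB N Y b \<Longrightarrow>
      frostman_weight \<gamma> cC TC N Z c \<Longrightarrow> ?strip \<epsilon> Y b Z c \<le> (sum b Y * sum c Z) / 2"
    by blast
  show ?thesis
  proof
    show "0 < \<epsilon>" by fact
    fix N Y b Z c
    assume N: "N0 \<le> N" and Yb: "frostman_weight \<beta> cB TB N Y b" and Zc: "frostman_weight \<gamma> cC TC N Z c"
    note Y = frostman_weightD[OF Yb] and Z = frostman_weightD[OF Zc]
    let ?j = "\<lambda>y z. j1 * y + j2 * z + j0"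
    let ?half = "\<lambda>\<sigma>. \<Sum>(y, z) | y \<in> Y \<and> z \<in> Z \<and> \<epsilon> < \<sigma> * ?j y z. b y * c z"
    have half: "?half \<sigma> = (\<Sum>z\<in>Z. \<Sum>y\<in>Y. if \<epsilon> < \<sigma> * ?j y z then b y * c z else 0)" for \<sigma>
    proof -
      have "?half \<sigma> = (\<Sum>(y, z)\<in>Y \<times> Z. if \<epsilon> < \<sigma> * ?j y z then b y * c z else 0)"
        using Y(1) Z(1) by (intro sum.mono_neutral_cong_left) (auto split: if_splits)
      also have "\<dots> = (\<Sum>y\<in>Y. \<Sum>z\<in>Z. if \<epsilon> < \<sigma> * ?j y z then b y * c z else 0)"
        by (simp add: sum.cartesian_product)
      finally show ?thesis by (subst sum.swap)
    qed
    have "sum b Y * sum c Z = (\<Sum>z\<in>Z. \<Sum>y\<in>Y. b y * c z)"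
      by (subst sum.swap) (simp add: sum_product)
    also have "\<dots> \<le> (\<Sum>z\<in>Z. \<Sum>y\<in>Y. (if \<bar>?j y z\<bar> \<le> \<epsilon> then b y * c z else 0)
        + ((if \<epsilon> < 1 * ?j y z then b y * c z else 0) + (if \<epsilon> < - 1 * ?j y z then b y * c z else 0)))"
      using Y(2) Z(2) by (intro sum_mono) auto
    also have "\<dots> = ?strip \<epsilon> Y b Z c + (?half 1 + ?half (- 1))"
      unfolding half by (simp only: sum.distrib)
    finally have "sum b Y * sum c Z \<le> ?strip \<epsilon> Y b Z c + (?half 1 + ?half (- 1))" .
    with \<epsilon>(2)[OF N Yb Zc] have "sum b Y * sum c Z / 2 \<le> ?half 1 + ?half (- 1)" by linarith
    moreover have "cB * cC \<le> sum b Y * sum c Z"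
      using Y Z \<beta> \<gamma> by (intro mult_mono) auto
    ultimately have "cB * cC / 4 \<le> ?half 1 \<or> cB * cC / 4 \<le> ?half (- 1)" by linarith
    then show "\<exists>\<sigma>\<in>{1, -1}. cB * cC / 4 \<le> ?half \<sigma>" by blast
  qed
qed

text \<open>For a quadratic map, the difference of two values is exactly the derivative at the
  midpoint applied to the difference of the arguments. The Jacobian being affine, this linear system
  has determinant \<open>D / 2\<close>, which stays away from 0 because both Jacobians have the sign
  \<open>\<sigma>\<close>; Cramer's rule inverts it.\<close>

lemma quadratic_map_expanding:
  fixes a b p1 p2 p3 q1 q2 y z y' z' :: real
  defines "v \<equiv> \<lambda>y z. a * y + b * z"
    and "w \<equiv> \<lambda>y z. p1 * y\<^sup>2 + p2 * y * z + p3 * z\<^sup>2 + q1 * y + q2 * z"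
    and "j \<equiv> \<lambda>y z. (a * p2 - 2 * b * p1) * y + (2 * a * p3 - b * p2) * z + (a * q2 - b * q1)"
  assumes J: "\<epsilon> < \<sigma> * j y z" "\<epsilon> < \<sigma> * j y' z'" and \<sigma>: "\<sigma> \<in> {1, -1}" and \<epsilon>: "0 < \<epsilon>"
    and bnd: "\<bar>y\<bar> \<le> L" "\<bar>z\<bar> \<le> L" "\<bar>y'\<bar> \<le> L" "\<bar>z'\<bar> \<le> L"
    and close: "\<bar>v y z - v y' z'\<bar> \<le> r" "\<bar>w y z - w y' z'\<bar> \<le> r"
    and Q: "\<bar>a\<bar> + \<bar>b\<bar> + 2 * (\<bar>p1\<bar> + \<bar>p2\<bar> + \<bar>p3\<bar>) * L + \<bar>q1\<bar> + \<bar>q2\<bar> \<le> Q"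
  shows "\<bar>y - y'\<bar> \<le> 2 * Q / \<epsilon> * r" "\<bar>z - z'\<bar> \<le> 2 * Q / \<epsilon> * r"
proof -
  \<comment> \<open>\<open>Py\<close> and \<open>Pz\<close> are twice the partial derivatives of
    \<open>w\<close> at the midpoint, matching \<open>D\<close>, which is twice the Jacobian
    there.\<close>
  define Py where "Py = 2 * (p1 * (y + y')) + p2 * (z + z') + 2 * q1"
  define Pz where "Pz = p2 * (y + y') + 2 * (p3 * (z + z')) + 2 * q2"
  define D where "D = j y z + j y' z'"
  have L: "0 \<le> L" using bnd by linarith
  have r: "0 \<le> r" using close by linarith
  have D: "2 * \<epsilon> < \<bar>D\<bar>"
  proof -
    have "\<sigma> = 1 \<or> \<sigma> = -1" using \<sigma> by simp
    then show ?thesis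
    proof
      assume "\<sigma> = 1"
      with J have "\<epsilon> < j y z" "\<epsilon> < j y' z'" by (simp_all only: mult_1)
      then show ?thesis unfolding D_def by linarith
    next
      assume "\<sigma> = -1"
      with J have "\<epsilon> < - j y z" "\<epsilon> < - j y' z'" by (simp_all only: mult_minus1)
      then show ?thesis unfolding D_def by linarith
    qed
  qed
  have e1: "D * (y - y') = (v y z - v y' z') * Pz - (w y z - w y' z') * (2 * b)"
    unfolding D_def v_def w_def j_def Py_def Pz_def by (simp add: algebra_simps power2_eq_square)
  have e2: "D * (z - z') = (w y z - w y' z') * (2 * a) - (v y z - v y' z') * Py"
    unfolding D_def v_def w_def j_def Py_def Pz_def by (simp add: algebra_simps power2_eq_square)
  have t: "\<bar>p * (u + u')\<bar> \<le> 2 * (\<bar>p\<bar> * L)" if "\<bar>u\<bar> \<le> L" "\<bar>u'\<bar> \<le> L" for p u u'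
  proof -
    have "\<bar>p * (u + u')\<bar> = \<bar>p\<bar> * \<bar>u + u'\<bar>" by (simp add: abs_mult)
    also have "\<dots> \<le> \<bar>p\<bar> * (2 * L)" using that by (intro mult_left_mono) auto
    finally show ?thesis by simp
  qed
  \<comment> \<open>opaque names keep \<open>linarith\<close> from splitting every absolute value\<close>
  obtain P1 P2 P3 a' b' r1 r2 where abs_eq: "P1 = \<bar>p1\<bar> * L" "P2 = \<bar>p2\<bar> * L" "P3 = \<bar>p3\<bar> * L"
    "a' = \<bar>a\<bar>" "b' = \<bar>b\<bar>" "r1 = \<bar>q1\<bar>" "r2 = \<bar>q2\<bar>" by simp
  have nn: "0 \<le> P1" "0 \<le> P2" "0 \<le> P3" "0 \<le> a'" "0 \<le> b'" "0 \<le> r1" "0 \<le> r2"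
    using L by (simp_all add: abs_eq)
  have Q': "a' + b' + 2 * P1 + 2 * P2 + 2 * P3 + r1 + r2 \<le> Q"
    using Q unfolding abs_eq by (simp add: algebra_simps)
  have tri: "\<bar>f + g + h\<bar> \<le> F + G + H" if "\<bar>f\<bar> \<le> F" "\<bar>g\<bar> \<le> G" "\<bar>h\<bar> \<le> H" for f g h F G H :: real
    using that by linarith
  have twice: "\<bar>2 * f\<bar> \<le> 2 * F" if "\<bar>f\<bar> \<le> F" for f F :: real
    using that by linarith
  have "\<bar>Py\<bar> \<le> 2 * (2 * P1) + 2 * P2 + 2 * r1"
    unfolding Py_def abs_eq by (intro tri twice t bnd order_refl)
  with nn Q' have Py: "\<bar>Py\<bar> \<le> 2 * Q" by linarith
  have "\<bar>Pz\<bar> \<le> 2 * P2 + 2 * (2 * P3) + 2 * r2"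
    unfolding Pz_def abs_eq by (intro tri twice t bnd order_refl)
  with nn Q' have Pz: "\<bar>Pz\<bar> \<le> 2 * Q" by linarith
  have "a' \<le> Q" "b' \<le> Q" using nn Q' by linarith+
  then have ab: "\<bar>2 * a\<bar> \<le> 2 * Q" "\<bar>2 * b\<bar> \<le> 2 * Q" unfolding abs_eq by (simp_all add: abs_mult)
  have fin: "\<bar>t\<bar> \<le> 2 * Q / \<epsilon> * r"
    if "D * t = f * g - f' * g'" "\<bar>f\<bar> \<le> r" "\<bar>g\<bar> \<le> 2 * Q" "\<bar>f'\<bar> \<le> r" "\<bar>g'\<bar> \<le> 2 * Q" for t f g f' g'
  proof -
    have "(2 * \<epsilon>) * \<bar>t\<bar> \<le> \<bar>D\<bar> * \<bar>t\<bar>" using D by (intro mult_right_mono) auto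
    also have "\<dots> = \<bar>f * g - f' * g'\<bar>" using that by (simp flip: abs_mult)
    also have "\<dots> \<le> \<bar>f * g\<bar> + \<bar>f' * g'\<bar>" by (rule abs_triangle_ineq4)
    also have "\<dots> \<le> r * (2 * Q) + r * (2 * Q)"
      unfolding abs_mult using that r by (intro add_mono mult_mono) auto
    finally have "\<epsilon> * \<bar>t\<bar> \<le> 2 * Q * r" by (simp add: algebra_simps)
    then show ?thesis using \<epsilon> by (simp add: field_simps)
  qed
  show "\<bar>y - y'\<bar> \<le> 2 * Q / \<epsilon> * r"
    by (rule fin[OF e1 close(1) Pz close(2) ab(2)])
  show "\<bar>z - z'\<bar> \<le> 2 * Q / \<epsilon> * r"
    by (rule fin[OF e2 close(2) ab(1) close(1) Py])
qed

text \<open>By expansion, the part of \<open>K\<close> mapped into a small square lies in a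
  rectangle around any one of its points, and the mass of a rectangle is a product of two ball
  masses. The distance \<open>2 * r\<close> arises because two such points are compared with each
  other instead of with the centre \<open>(v', w')\<close>.\<close>

lemma frostman_product:
  fixes v w :: "real \<times> real \<Rightarrow> real"
  assumes Yb: "frostman_weight \<beta> cB TB N Y b" and Zc: "frostman_weight \<gamma> cC TC N Z c"
    and pos: "0 < TB" "0 < TC" "0 < \<beta>" "0 < \<gamma>" and K: "K \<subseteq> Y \<times> Z"
    and expand: "\<And>k k'. k \<in> K \<Longrightarrow> k' \<in> K \<Longrightarrow> \<bar>v k - v k'\<bar> \<le> 2 * r \<Longrightarrow> \<bar>w k - w k'\<bar> \<le> 2 * r \<Longrightarrow>
      \<bar>fst k - fst k'\<bar> \<le> \<Lambda> * r \<and> \<bar>snd k - snd k'\<bar> \<le> \<Lambda> * r"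
    and \<Lambda>: "1 \<le> \<Lambda>" and r: "1 / 2 ^ N \<le> r"
  shows "(\<Sum>k | k \<in> K \<and> \<bar>v k - v'\<bar> \<le> r \<and> \<bar>w k - w'\<bar> \<le> r. b (fst k) * c (snd k))
    \<le> TB * TC * \<Lambda> powr (\<beta> + \<gamma>) * r powr (\<beta> + \<gamma>)"
proof (cases "{k \<in> K. \<bar>v k - v'\<bar> \<le> r \<and> \<bar>w k - w'\<bar> \<le> r} = {}")
  case True
  then show ?thesis using pos unfolding True by simp
next
  case False
  then obtain k0 where k0: "k0 \<in> K" "\<bar>v k0 - v'\<bar> \<le> r" "\<bar>w k0 - w'\<bar> \<le> r" by auto
  note Y = frostman_weightD[OF Yb] and Z = frostman_weightD[OF Zc]
  have r0: "0 < r" using r by (smt (verit) divide_pos_pos zero_less_power)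
  let ?\<rho> = "\<Lambda> * r"
  let ?Y = "{y \<in> Y. \<bar>y - fst k0\<bar> \<le> ?\<rho>}" and ?Z = "{z \<in> Z. \<bar>z - snd k0\<bar> \<le> ?\<rho>}"
  have "{k \<in> K. \<bar>v k - v'\<bar> \<le> r \<and> \<bar>w k - w'\<bar> \<le> r} \<subseteq> ?Y \<times> ?Z"
  proof
    fix k assume "k \<in> {k \<in> K. \<bar>v k - v'\<bar> \<le> r \<and> \<bar>w k - w'\<bar> \<le> r}"
    then have k: "k \<in> K" "\<bar>v k - v'\<bar> \<le> r" "\<bar>w k - w'\<bar> \<le> r" by auto
    then have "\<bar>v k - v k0\<bar> \<le> 2 * r" "\<bar>w k - w k0\<bar> \<le> 2 * r" using k0 by linarith+
    with expand[OF k(1) k0(1)] K k(1) show "k \<in> ?Y \<times> ?Z" by (cases k) auto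
  qed
  then have "(\<Sum>k | k \<in> K \<and> \<bar>v k - v'\<bar> \<le> r \<and> \<bar>w k - w'\<bar> \<le> r. b (fst k) * c (snd k))
      \<le> (\<Sum>k\<in>?Y \<times> ?Z. b (fst k) * c (snd k))"
    by (intro sum_mono2) (use Y Z in auto)
  also have "\<dots> = sum b ?Y * sum c ?Z"
    by (simp add: sum_product sum.cartesian_product case_prod_beta)
  also have "\<dots> \<le> (TB * ?\<rho> powr \<beta>) * (TC * ?\<rho> powr \<gamma>)"
  proof -
    have mass: "sum a {x \<in> X. \<bar>x - y\<bar> \<le> ?\<rho>} \<le> T * ?\<rho> powr s"
      if Xa: "frostman_weight s c T N X a" and "0 < T" "0 < s" for s c T X a y
    \<comment> \<open>The enlarged radius may leave the range of the ball condition; beyond 1 the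
      total mass suffices, as the power is then at least 1.\<close>
    proof (cases "?\<rho> \<le> 1")
      case True
      have "1 * r \<le> ?\<rho>" using \<Lambda> r0 by (intro mult_right_mono) auto
      then show ?thesis using frostman_weightD(5)[OF Xa _ True] r by simp
    next
      case False
      have "sum a {x \<in> X. \<bar>x - y\<bar> \<le> ?\<rho>} \<le> sum a X"
        using frostman_weightD[OF Xa] by (intro sum_mono2) auto
      also have "\<dots> \<le> T * 1" using frostman_weightD[OF Xa] by simp
      also have "\<dots> \<le> T * ?\<rho> powr s"
        using False that by (intro mult_left_mono ge_one_powr_ge_zero) auto
      finally show ?thesis .
    qed
    show ?thesis
      using mass[OF Yb pos(1,3)] mass[OF Zc pos(2,4)] Y Z pos by (intro mult_mono sum_nonneg) auto
  qed
  also have "\<dots> = TB * TC * \<Lambda> powr (\<beta> + \<gamma>) * r powr (\<beta> + \<gamma>)"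
    using \<Lambda> r0 by (simp add: powr_mult powr_add mult_ac)
  finally show ?thesis .
qed

section \<open>Images of positive measure\<close>

text \<open>The projection theorem in counting form. Product weights on one sign region of the
  Jacobian form a \<open>frostman_pair\<close> at scale \<open>1 / 2 ^ N\<close>, and its energy
  bound limits how few cells the projections can occupy. All constants are chosen before
  \<open>N\<close>.\<close>

lemma projection_count:
  fixes a b p1 p2 p3 q1 q2 :: real and r :: "real \<Rightarrow> real"
  defines "v \<equiv> \<lambda>y z. a * y + b * z"
    and "w \<equiv> \<lambda>y z. p1 * y\<^sup>2 + p2 * y * z + p3 * z\<^sup>2 + q1 * y + q2 * z"
  assumes bounded: "bounded A" "bounded B" "bounded C"
    and \<alpha>: "0 < \<alpha>" "\<alpha> \<le> 2" "ennreal \<alpha> < hausdorff_dim A"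
    and \<beta>: "0 < \<beta>" "ennreal \<beta> < hausdorff_dim B"
    and \<gamma>: "0 < \<gamma>" "ennreal \<gamma> < hausdorff_dim C"
    and dim: "2 < \<alpha> + \<beta> + \<gamma>"
    and J: "(a * q2 - b * q1, a * p2 - 2 * b * p1, 2 * a * p3 - b * p2) \<noteq> (0, 0, 0)"
  obtains c :: real and N0 :: nat where "0 < c"
    "\<And>N P. N0 \<le> N \<Longrightarrow> finite P \<Longrightarrow>
      (\<And>x y z. x \<in> A \<Longrightarrow> y \<in> B \<Longrightarrow> z \<in> C \<Longrightarrow> \<lfloor>2 ^ N * (r x + (x * v y z + w y z))\<rfloor> \<in> P) \<Longrightarrow>
      c * 2 ^ N \<le> card P"
proof -
  obtain cA TA where A: "0 < cA" "0 < TA" "\<And>N. \<exists>X m. X \<subseteq> A \<and> frostman_weight \<alpha> cA TA N X m"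
    by (rule ex_frostman_weight[OF bounded(1) \<alpha>(1,3)]) blast
  obtain cB TB where B: "0 < cB" "0 < TB" "\<And>N. \<exists>X m. X \<subseteq> B \<and> frostman_weight \<beta> cB TB N X m"
    by (rule ex_frostman_weight[OF bounded(2) \<beta>]) blast
  obtain cC TC where C: "0 < cC" "0 < TC" "\<And>N. \<exists>X m. X \<subseteq> C \<and> frostman_weight \<gamma> cC TC N X m"
    by (rule ex_frostman_weight[OF bounded(3) \<gamma>]) blast
  have "bounded (A \<union> B \<union> C)" using bounded by simp
  then obtain L' where L': "\<And>x. x \<in> A \<union> B \<union> C \<Longrightarrow> \<bar>x\<bar> \<le> L'" by (auto simp: bounded_iff)
  define L where "L = max 1 L'"
  have L: "1 \<le> L" "\<And>x. x \<in> A \<Longrightarrow> \<bar>x\<bar> \<le> L" "\<And>x. x \<in> B \<Longrightarrow> \<bar>x\<bar> \<le> L" "\<And>x. x \<in> C \<Longrightarrow> \<bar>x\<bar> \<le> L"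
    using L' unfolding L_def by (auto intro: max.coboundedI2)
  define j where "j y z = (a * p2 - 2 * b * p1) * y + (2 * a * p3 - b * p2) * z + (a * q2 - b * q1)" for y z
  obtain \<epsilon> N0 where \<epsilon>: "0 < \<epsilon>" and part:
    "\<And>N Y b' Z c. N0 \<le> N \<Longrightarrow> frostman_weight \<beta> cB TB N Y b' \<Longrightarrow> frostman_weight \<gamma> cC TC N Z c \<Longrightarrow>
       \<exists>\<sigma>\<in>{1, -1}. cB * cC / 4 \<le> (\<Sum>(y, z) | y \<in> Y \<and> z \<in> Z \<and> \<epsilon> < \<sigma> * j y z. b' y * c z)"
    unfolding j_def using ex_nondegenerate_part[OF \<beta>(1) B(1,2) \<gamma>(1) C(1,2) J] by blast
  define Q where "Q = \<bar>a\<bar> + \<bar>b\<bar> + 2 * (\<bar>p1\<bar> + \<bar>p2\<bar> + \<bar>p3\<bar>) * L + \<bar>q1\<bar> + \<bar>q2\<bar>"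
  \<comment> \<open>The expansion estimate is applied at distance \<open>2 * \<rho>\<close>, which
    doubles its factor \<open>2 * Q / \<epsilon>\<close>.\<close>
  define \<Lambda> where "\<Lambda> = max 1 (2 * (2 * Q / \<epsilon>))"
  \<comment> \<open>\<open>M\<close> has to bound both the slopes and the values of
    \<open>a * y + b * z\<close>.\<close>
  define M where "M = (1 + \<bar>a\<bar> + \<bar>b\<bar>) * L"
  define D where "D = TB * TC * \<Lambda> powr (\<beta> + \<gamma>)"
  \<comment> \<open>By \<open>energy_bound\<close>, \<open>H\<close> dominates
    \<open>exp (1/2) * (2 ^ N * E (2 ^ N))\<close>. The denominator \<open>\<bar>H\<bar> + 1\<close>
    of \<open>c\<close> is positive without further discussion of \<open>H\<close>.\<close>
  define H where "H = exp (1/2) * (TA * D\<^sup>2 + frostman_pair.const TA D M / (1 - 2 powr (2 - \<alpha> - (\<beta> + \<gamma>))))"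
  define c where "c = cA * (cB * cC / 4)\<^sup>2 / (\<bar>H\<bar> + 1)"
  have \<Lambda>: "1 \<le> \<Lambda>" by (simp add: \<Lambda>_def)
  have L_le: "1 \<le> M" "L \<le> M"
  proof -
    have "1 * L \<le> M" unfolding M_def using L by (intro mult_right_mono) auto
    then show "1 \<le> M" "L \<le> M" using L by auto
  qed
  show ?thesis
  proof
    show "0 < c" unfolding c_def using A B C by (intro divide_pos_pos mult_pos_pos zero_less_power) auto
    fix N P
    assume N: "N0 \<le> N" and P: "finite P"
      and cell: "\<And>x y z. x \<in> A \<Longrightarrow> y \<in> B \<Longrightarrow> z \<in> C \<Longrightarrow> \<lfloor>2 ^ N * (r x + (x * v y z + w y z))\<rfloor> \<in> P"
    obtain X m1 where X: "X \<subseteq> A" "frostman_weight \<alpha> cA TA N X m1" using A(3) by blast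
    obtain Y m2 where Y: "Y \<subseteq> B" "frostman_weight \<beta> cB TB N Y m2" using B(3) by blast
    obtain Z m3 where Z: "Z \<subseteq> C" "frostman_weight \<gamma> cC TC N Z m3" using C(3) by blast
    obtain \<sigma> where \<sigma>: "\<sigma> \<in> {1, -1}"
      "cB * cC / 4 \<le> (\<Sum>(y, z) | y \<in> Y \<and> z \<in> Z \<and> \<epsilon> < \<sigma> * j y z. m2 y * m3 z)"
      using part[OF N Y(2) Z(2)] by blast
    define K where "K = {(y, z). y \<in> Y \<and> z \<in> Z \<and> \<epsilon> < \<sigma> * j y z}"
    define m where "m k = m2 (fst k) * m3 (snd k)" for k
    define v' where "v' k = v (fst k) (snd k)" for k
    define w' where "w' k = w (fst k) (snd k)" for k
    note X' = frostman_weightD[OF X(2)] and Y' = frostman_weightD[OF Y(2)] and Z' = frostman_weightD[OF Z(2)]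
    have KYZ: "K \<subseteq> Y \<times> Z" by (auto simp: K_def)
    then have finK: "finite K" using Y'(1) Z'(1) finite_subset by blast
    have KBC: "fst k \<in> B" "snd k \<in> C" if "k \<in> K" for k
      using that Y(1) Z(1) by (auto simp: K_def)
    have frost: "(\<Sum>k | k \<in> K \<and> \<bar>v' k - v0\<bar> \<le> \<rho> \<and> \<bar>w' k - w0\<bar> \<le> \<rho>. m k) \<le> D * \<rho> powr (\<beta> + \<gamma>)"
      if "1 / 2 ^ N \<le> \<rho>" "\<rho> \<le> 1" for \<rho> v0 w0
      unfolding m_def D_def
    proof (rule frostman_product[OF Y(2) Z(2) B(2) C(2) \<beta>(1) \<gamma>(1) KYZ _ \<Lambda> that(1)])
      fix k k' assume k: "k \<in> K" "k' \<in> K" and close: "\<bar>v' k - v' k'\<bar> \<le> 2 * \<rho>" "\<bar>w' k - w' k'\<bar> \<le> 2 * \<rho>"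
      have \<rho>0: "0 \<le> \<rho>" using that by (meson order_trans zero_le_divide_1_iff zero_le_numeral zero_le_power)
      have bnd: "\<bar>fst k\<bar> \<le> L" "\<bar>snd k\<bar> \<le> L" "\<bar>fst k'\<bar> \<le> L" "\<bar>snd k'\<bar> \<le> L"
        using k KBC L by auto
      have jk: "\<epsilon> < \<sigma> * j (fst k) (snd k)" "\<epsilon> < \<sigma> * j (fst k') (snd k')"
        using k by (auto simp: K_def)
      have "2 * Q / \<epsilon> * (2 * \<rho>) = 2 * (2 * Q / \<epsilon>) * \<rho>" by simp
      also have "\<dots> \<le> \<Lambda> * \<rho>" unfolding \<Lambda>_def using \<rho>0 by (intro mult_right_mono) auto
      finally have le: "2 * Q / \<epsilon> * (2 * \<rho>) \<le> \<Lambda> * \<rho>" .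
      note exp = quadratic_map_expanding[OF jk[unfolded j_def] \<sigma>(1) \<epsilon> bnd
          close[unfolded v'_def w'_def v_def w_def] order_refl, folded Q_def]
      show "\<bar>fst k - fst k'\<bar> \<le> \<Lambda> * \<rho> \<and> \<bar>snd k - snd k'\<bar> \<le> \<Lambda> * \<rho>"
        using exp le by linarith
    qed
    have total: "sum m K \<le> D"
    proof -
      have "sum m K \<le> sum m (Y \<times> Z)"
        using KYZ Y' Z' by (intro sum_mono2) (auto simp: m_def)
      also have "\<dots> = sum m2 Y * sum m3 Z"
        by (simp add: m_def sum_product sum.cartesian_product case_prod_beta)
      also have "\<dots> \<le> TB * TC" using Y' Z' B by (intro mult_mono sum_nonneg) auto
      also have "\<dots> * 1 \<le> D" unfolding D_def
        using B C \<Lambda> \<beta> \<gamma> by (intro mult_left_mono ge_one_powr_ge_zero) auto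
      finally show ?thesis by simp
    qed
    interpret frostman_pair X m1 K m v' w' "1 / 2 ^ N" \<alpha> "\<beta> + \<gamma>" TA D M
    proof
      show "finite X" "\<And>x. x \<in> X \<Longrightarrow> 0 \<le> m1 x" "sum m1 X \<le> TA" using X' by auto
      show "(\<Sum>x | x \<in> X \<and> \<bar>x - y\<bar> \<le> \<rho>. m1 x) \<le> TA * \<rho> powr \<alpha>" if "1 / 2 ^ N \<le> \<rho>" "\<rho> \<le> 1" for y \<rho>
        using X'(5)[OF that] .
      show "\<bar>x\<bar> \<le> M" if "x \<in> X" for x using that X(1) L(2) L_le by force
      show "finite K" "sum m K \<le> D" "1 \<le> M" "\<alpha> \<le> 2" by fact+
      show "0 \<le> m k" for k using Y'(2) Z'(2) by (simp add: m_def)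
      show "\<bar>v' k\<bar> \<le> M" if "k \<in> K" for k
      proof -
        have "\<bar>a * fst k\<bar> \<le> \<bar>a\<bar> * L" "\<bar>b * snd k\<bar> \<le> \<bar>b\<bar> * L"
          using L KBC[OF that] by (auto simp: abs_mult intro: mult_left_mono)
        then have "\<bar>v' k\<bar> \<le> \<bar>a\<bar> * L + \<bar>b\<bar> * L"
          unfolding v'_def v_def by (meson abs_triangle_ineq add_mono order_trans)
        then show ?thesis unfolding M_def using L(1) by (simp add: distrib_right)
      qed
      show "(\<Sum>k | k \<in> K \<and> \<bar>v' k - v0\<bar> \<le> \<rho> \<and> \<bar>w' k - w0\<bar> \<le> \<rho>. m k) \<le> D * \<rho> powr (\<beta> + \<gamma>)"
        if "1 / 2 ^ N \<le> \<rho>" "\<rho> \<le> 1" for v0 w0 \<rho> by (rule frost[OF that])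
    qed simp
    have "cA * (cB * cC / 4)\<^sup>2 \<le> sum m1 X * (sum m K)\<^sup>2"
    proof (intro mult_mono power_mono)
      show "cB * cC / 4 \<le> sum m K"
        using \<sigma>(2) by (simp add: K_def m_def case_prod_beta)
    qed (use X' A B C in \<open>auto intro: sum_nonneg\<close>)
    also have "\<dots> \<le> card P * (exp (1/2) * E (2 ^ N))"
    proof (rule mass_le_card_cells[OF P])
      fix x k assume "x \<in> X" "k \<in> K"
      then show "\<lfloor>2 ^ N * (r x + (x * v' k + w' k))\<rfloor> \<in> P"
        unfolding v'_def w'_def using X(1) KBC by (intro cell) auto
    qed
    finally have "cA * (cB * cC / 4)\<^sup>2 * 2 ^ N \<le> card P * (exp (1/2) * E (2 ^ N)) * 2 ^ N"
      by (rule mult_right_mono) simp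
    also have "\<dots> = card P * (exp (1/2) * (2 ^ N * E (2 ^ N)))" by simp
    also have "\<dots> \<le> card P * H"
      unfolding H_def using dim by (intro mult_left_mono energy_bound) auto
    also have "\<dots> \<le> card P * (\<bar>H\<bar> + 1)" by (intro mult_left_mono) auto
    finally show "c * 2 ^ N \<le> card P"
      unfolding c_def by (simp add: field_simps)
  qed
qed

text \<open>A null \<open>K\<close> would have an open neighbourhood \<open>U\<close> of measure
  below \<open>c\<close>. By compactness \<open>U\<close> contains all cells of some fine level that
  meet \<open>K\<close>; these are disjoint and, by the count, of total length at least
  \<open>c\<close>.\<close>

lemma emeasure_pos_if_many_cells:
  fixes K :: "real set" and c :: real
  assumes K: "compact K" and c: "0 < c"
    and count: "\<And>N P. N0 \<le> N \<Longrightarrow> finite P \<Longrightarrow> (\<And>t. t \<in> K \<Longrightarrow> \<lfloor>2 ^ N * t\<rfloor> \<in> P) \<Longrightarrow> c * 2 ^ N \<le> card P"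
  shows "0 < emeasure lborel K"
proof (rule ccontr)
  assume "\<not> 0 < emeasure lborel K"
  then have K0: "emeasure lborel K = 0" by simp
  have Kb: "K \<in> sets borel" using K by (simp add: borel_compact)
  obtain U where U: "open U" "K \<subseteq> U" "emeasure lborel (U - K) < c"
    using outer_regular_lborel[OF Kb c] by blast
  have "emeasure lborel U \<le> emeasure lborel K + emeasure lborel (U - K)"
  proof -
    have "K \<union> (U - K) = U" using U by blast
    then show ?thesis using emeasure_subadditive[of K lborel "U - K"] Kb U(1) by auto
  qed
  then have Uc: "emeasure lborel U < c" using K0 U(3) by simp
  obtain \<epsilon> where \<epsilon>: "0 < \<epsilon>" "(\<Union>x\<in>K. ball x \<epsilon>) \<subseteq> U"
    using compact_subset_open_imp_ball_epsilon_subset[OF K U(1,2)] by blast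
  obtain N1 where N1: "(1 / 2) ^ N1 < \<epsilon>" using real_arch_pow_inv[of \<epsilon> "1/2"] \<epsilon> by auto
  define N where "N = max N0 N1"
  have N: "N0 \<le> N" "1 / 2 ^ N < \<epsilon>"
    using N1 power_decreasing[of N1 N "1/2::real"] by (auto simp: N_def power_one_over)
  define P where "P = (\<lambda>t. \<lfloor>2 ^ N * t\<rfloor>) ` K"
  obtain b where b: "\<And>t. t \<in> K \<Longrightarrow> \<bar>t\<bar> \<le> b"
    using compact_imp_bounded[OF K] by (auto simp: bounded_iff)
  have "P \<subseteq> {\<lfloor>- (2 ^ N * b)\<rfloor>..\<lfloor>2 ^ N * b\<rfloor>}"
  proof
    fix p assume "p \<in> P"
    then obtain t where t: "t \<in> K" "p = \<lfloor>2 ^ N * t\<rfloor>" by (auto simp: P_def)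
    have "2 ^ N * t \<le> 2 ^ N * b" "2 ^ N * - b \<le> 2 ^ N * t"
      using b[OF t(1)] by (intro mult_left_mono; simp)+
    then show "p \<in> {\<lfloor>- (2 ^ N * b)\<rfloor>..\<lfloor>2 ^ N * b\<rfloor>}" using t by (auto intro: floor_mono)
  qed
  then have P: "finite P" by (rule finite_subset) simp
  have card: "c * 2 ^ N \<le> card P" by (rule count[OF N(1) P]) (simp add: P_def)
  have sub: "(\<Union>p\<in>P. dyadic N p) \<subseteq> U"
  proof safe
    fix p s assume p: "p \<in> P" and s: "s \<in> dyadic N p"
    then obtain t where t: "t \<in> K" "p = \<lfloor>2 ^ N * t\<rfloor>" by (auto simp: P_def)
    have "t \<in> dyadic N p" using t by (simp add: dyadic_def mult.commute)
    with s have "dist t s \<le> 1 / 2 ^ N"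
      unfolding dyadic_eq_interval dist_real_def by (auto simp: add_divide_distrib abs_le_iff)
    then have "s \<in> ball t \<epsilon>" using N by simp
    then show "s \<in> U" using \<epsilon>(2) t(1) by blast
  qed
  have em: "emeasure lborel (dyadic N p) = ennreal (1 / 2 ^ N)" for p
    unfolding dyadic_eq_interval by (simp add: divide_right_mono diff_divide_distrib[symmetric])
  have "ennreal (card P * (1 / 2 ^ N)) = (\<Sum>p\<in>P. emeasure lborel (dyadic N p))"
    by (simp add: em ennreal_of_nat_eq_real_of_nat flip: ennreal_mult)
  also have "\<dots> = emeasure lborel (\<Union>p\<in>P. dyadic N p)"
    by (rule sum_emeasure) (use P in \<open>auto simp: disjoint_family_on_def dyadic_eq_interval[symmetric] dyadic_def[of N]\<close>)
  also have "\<dots> \<le> emeasure lborel U"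
    using U(1) by (intro emeasure_mono sub) auto
  finally have "ennreal (card P * (1 / 2 ^ N)) < ennreal c" using Uc by simp
  then have "card P * (1 / 2 ^ N) < c" using c by (simp add: ennreal_less_iff)
  then show False using card by (simp add: field_simps)
qed

lemma ex_exponents:
  fixes a b c :: ennreal
  assumes le: "a \<le> 1" "b \<le> 1" "c \<le> 1" and sum: "2 < a + b + c"
  obtains \<alpha> \<beta> \<gamma> where "0 < \<alpha>" "0 < \<beta>" "0 < \<gamma>" "\<alpha> \<le> 2" "ennreal \<alpha> < a" "ennreal \<beta> < b" "ennreal \<gamma> < c"
    "2 < \<alpha> + \<beta> + \<gamma>"
proof -
  have real: "\<exists>x. u = ennreal x \<and> 0 \<le> x \<and> x \<le> 1" if "u \<le> 1" for u
    using that by (cases u) (auto simp: top_unique)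
  obtain x y z where x: "a = ennreal x" "0 \<le> x" "x \<le> 1" and y: "b = ennreal y" "0 \<le> y" "y \<le> 1"
    and z: "c = ennreal z" "0 \<le> z" "z \<le> 1"
    using real le by meson
  have "ennreal 2 < ennreal (x + y + z)" using sum x y z by simp
  then have xyz: "2 < x + y + z" by (simp add: ennreal_less_iff)
  \<comment> \<open>A sixth of the surplus is removed from each exponent, leaving half of it in the
    sum. As all dimensions are at most 1, the surplus is at most each of \<open>x\<close>,
    \<open>y\<close>, \<open>z\<close>, so the exponents stay positive.\<close>
  define t where "t = (x + y + z - 2) / 6"
  have t: "0 < t" "t < x" "t < y" "t < z" "6 * t = x + y + z - 2" using xyz x y z by (auto simp: t_def)
  show ?thesis
    by (rule that[of "x - t" "y - t" "z - t"]) (use t x y z in \<open>auto simp: ennreal_less_iff\<close>)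
qed

text \<open>The triple in the last assumption lists the constant term and the coefficients of
  \<open>y\<close> and \<open>z\<close> of the affine Jacobian. Compactness of the image allows
  passing from cell counts to measure.\<close>

lemma quadratic_image_pos:
  fixes F :: "real \<Rightarrow> real \<Rightarrow> real \<Rightarrow> real"
  assumes F: "\<And>x y z. F x y z = r0 + r1 * x + r2 * x\<^sup>2
      + (x * (a * y + b * z) + (p1 * y\<^sup>2 + p2 * y * z + p3 * z\<^sup>2 + q1 * y + q2 * z))"
    and compact: "compact A" "compact B" "compact C"
    and dim: "2 < hausdorff_dim A + hausdorff_dim B + hausdorff_dim C"
    and J: "(a * q2 - b * q1, a * p2 - 2 * b * p1, 2 * a * p3 - b * p2) \<noteq> (0, 0, 0)"
  shows "0 < emeasure lebesgue {F x y z | x y z. x \<in> A \<and> y \<in> B \<and> z \<in> C}"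
proof -
  let ?K = "{F x y z | x y z. x \<in> A \<and> y \<in> B \<and> z \<in> C}"
  have bounded: "bounded A" "bounded B" "bounded C" using compact by (auto intro: compact_imp_bounded)
  obtain \<alpha> \<beta> \<gamma> where e: "0 < \<alpha>" "0 < \<beta>" "0 < \<gamma>" "\<alpha> \<le> 2" "ennreal \<alpha> < hausdorff_dim A"
    "ennreal \<beta> < hausdorff_dim B" "ennreal \<gamma> < hausdorff_dim C" "2 < \<alpha> + \<beta> + \<gamma>"
    using ex_exponents[OF hausdorff_dim_le_1[OF bounded(1)] hausdorff_dim_le_1[OF bounded(2)]
        hausdorff_dim_le_1[OF bounded(3)] dim] by blast
  have K: "compact ?K"
  proof -
    have "?K = (\<lambda>t. F (fst t) (fst (snd t)) (snd (snd t))) ` (A \<times> B \<times> C)"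
      by (auto simp: image_iff) blast+
    moreover have "continuous_on (A \<times> B \<times> C) (\<lambda>t. F (fst t) (fst (snd t)) (snd (snd t)))"
      unfolding F by (intro continuous_intros)
    ultimately show ?thesis
      using compact by (simp add: compact_continuous_image compact_Times)
  qed
  obtain c :: real and N0 :: nat where c: "0 < c" "\<And>N P. N0 \<le> N \<Longrightarrow> finite P \<Longrightarrow>
      (\<And>x y z. x \<in> A \<Longrightarrow> y \<in> B \<Longrightarrow> z \<in> C \<Longrightarrow> \<lfloor>2 ^ N * (r0 + r1 * x + r2 * x\<^sup>2
      + (x * (a * y + b * z) + (p1 * y\<^sup>2 + p2 * y * z + p3 * z\<^sup>2 + q1 * y + q2 * z)))\<rfloor> \<in> P) \<Longrightarrow>
      c * 2 ^ N \<le> card P"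
    by (rule projection_count[OF bounded e(1,4,5) e(2,6) e(3,7,8) J, of "\<lambda>x. r0 + r1 * x + r2 * x\<^sup>2"]) blast
  have "0 < emeasure lborel ?K"
  proof (rule emeasure_pos_if_many_cells[OF K c(1)])
    fix N P
    assume N: "N0 \<le> N" "finite P" and cell: "\<And>t. t \<in> ?K \<Longrightarrow> \<lfloor>2 ^ N * t\<rfloor> \<in> P"
    show "c * 2 ^ N \<le> card P"
    proof (rule c(2)[OF N])
      fix x y z assume "x \<in> A" "y \<in> B" "z \<in> C"
      then have "F x y z \<in> ?K" by blast
      from cell[OF this] show "\<lfloor>2 ^ N * (r0 + r1 * x + r2 * x\<^sup>2
        + (x * (a * y + b * z) + (p1 * y\<^sup>2 + p2 * y * z + p3 * z\<^sup>2 + q1 * y + q2 * z)))\<rfloor> \<in> P"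
        by (simp only: F)
    qed
  qed
  then show ?thesis using K by (simp add: borel_compact)
qed

section \<open>Quadratic polynomials in three variables\<close>

lemma eval3_quadratic:
  assumes "total_degree3 f = 2"
  shows "eval3 f x y z = Poly_Mapping.lookup f (0, 0, 0)
    + Poly_Mapping.lookup f (1, 0, 0) * x + Poly_Mapping.lookup f (0, 1, 0) * y + Poly_Mapping.lookup f (0, 0, 1) * z
    + Poly_Mapping.lookup f (2, 0, 0) * x\<^sup>2 + Poly_Mapping.lookup f (0, 2, 0) * y\<^sup>2 + Poly_Mapping.lookup f (0, 0, 2) * z\<^sup>2
    + Poly_Mapping.lookup f (1, 1, 0) * x * y + Poly_Mapping.lookup f (1, 0, 1) * x * z
    + Poly_Mapping.lookup f (0, 1, 1) * y * z"
    and "\<And>i j k. (i, j, k) \<in> Poly_Mapping.keys f \<Longrightarrow> i + j + k \<le> 2"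
proof -
  show deg: "i + j + k \<le> 2" if "(i, j, k) \<in> Poly_Mapping.keys f" for i j k
  proof -
    have "i + j + k \<in> insert 0 ((\<lambda>(i, j, k). i + j + k) ` Poly_Mapping.keys f)"
      using that by force
    then have "i + j + k \<le> Max (insert 0 ((\<lambda>(i, j, k). i + j + k) ` Poly_Mapping.keys f))"
      by (intro Max_ge) auto
    then show ?thesis using assms by (simp add: total_degree3_def)
  qed
  let ?S = "{(0, 0, 0), (1, 0, 0), (0, 1, 0), (0, 0, 1), (2, 0, 0), (0, 2, 0), (0, 0, 2),
    (1, 1, 0), (1, 0, 1), (0, 1, 1)} :: (nat \<times> nat \<times> nat) set"
  have "Poly_Mapping.keys f \<subseteq> ?S"
  proof
    fix t assume t: "t \<in> Poly_Mapping.keys f"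
    obtain i j k where ijk: "t = (i, j, k)" by (cases t)
    have "i + j + k \<le> 2" using deg t ijk by blast
    then have "i = 0 \<and> (j = 0 \<and> (k = 0 \<or> k = 1 \<or> k = 2) \<or> j = 1 \<and> (k = 0 \<or> k = 1) \<or> j = 2 \<and> k = 0)
      \<or> i = 1 \<and> (j = 0 \<and> (k = 0 \<or> k = 1) \<or> j = 1 \<and> k = 0) \<or> i = 2 \<and> j = 0 \<and> k = 0"
      by presburger
    then show "t \<in> ?S" unfolding ijk by auto
  qed
  then have "eval3 f x y z = (\<Sum>(i, j, k)\<in>?S. Poly_Mapping.lookup f (i, j, k) * x ^ i * y ^ j * z ^ k)"
    unfolding eval3_def
    by (intro sum.mono_neutral_left) (auto simp: in_keys_iff)
  then show "eval3 f x y z = Poly_Mapping.lookup f (0, 0, 0)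
    + Poly_Mapping.lookup f (1, 0, 0) * x + Poly_Mapping.lookup f (0, 1, 0) * y + Poly_Mapping.lookup f (0, 0, 1) * z
    + Poly_Mapping.lookup f (2, 0, 0) * x\<^sup>2 + Poly_Mapping.lookup f (0, 2, 0) * y\<^sup>2 + Poly_Mapping.lookup f (0, 0, 2) * z\<^sup>2
    + Poly_Mapping.lookup f (1, 1, 0) * x * y + Poly_Mapping.lookup f (1, 0, 1) * x * z
    + Poly_Mapping.lookup f (0, 1, 1) * y * z"
    by simp
qed

text \<open>The nine equations express that the Jacobians vanish for every choice of the singled-out
  variable. Without mixed terms \<open>F\<close> is a sum of one-variable polynomials; otherwise all
  mixed coefficients are nonzero and \<open>F\<close> is a quadratic polynomial in one linear
  form.\<close>

lemma quadratic_special_form: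
  fixes F :: "real \<Rightarrow> real \<Rightarrow> real \<Rightarrow> real"
  assumes F: "\<And>x y z. F x y z = c0 + l1 * x + l2 * y + l3 * z + s1 * x\<^sup>2 + s2 * y\<^sup>2 + s3 * z\<^sup>2
      + d * x * y + e * x * z + g * y * z"
    and J1: "d * l3 - e * l2 = 0" "d * g - 2 * e * s2 = 0" "2 * d * s3 - e * g = 0"
    and J2: "d * l3 - g * l1 = 0" "d * e - 2 * g * s1 = 0" "2 * d * s3 - g * e = 0"
    and J3: "e * l2 - g * l1 = 0" "e * d - 2 * g * s1 = 0" "2 * e * s2 - g * d = 0"
    and dep: "(l1, s1, d, e) \<noteq> (0, 0, 0, 0)" "(l2, s2, d, g) \<noteq> (0, 0, 0, 0)" "(l3, s3, e, g) \<noteq> (0, 0, 0, 0)"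
  shows "\<exists>G h k l :: real poly. \<forall>x y z. F x y z = poly G (poly h x + poly k y + poly l z)"
proof (cases "d = 0 \<and> e = 0 \<and> g = 0")
  case True
  show ?thesis
    by (rule exI[of _ "[:0, 1:]"], rule exI[of _ "[:c0, l1, s1:]"], rule exI[of _ "[:0, l2, s2:]"],
        rule exI[of _ "[:0, l3, s3:]"]) (simp add: F True power2_eq_square algebra_simps)
next
  case False
  \<comment> \<open>A vanishing mixed coefficient would make the equations either erase a variable
    from \<open>F\<close> or force \<open>d * e = 0\<close>.\<close>
  have nz: "d \<noteq> 0" "e \<noteq> 0" "g \<noteq> 0"
  proof -
    show "d \<noteq> 0"
    proof
      assume "d = 0"
      then show False using False J1 J2 J3 dep(1,2) by (cases "e = 0") auto
    qed
    show "e \<noteq> 0"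
    proof
      assume "e = 0"
      then show False using \<open>d \<noteq> 0\<close> J1 J2 dep(3) by simp
    qed
    show "g \<noteq> 0"
    proof
      assume "g = 0"
      then show False using \<open>d \<noteq> 0\<close> \<open>e \<noteq> 0\<close> J2 by simp
    qed
  qed
  \<comment> \<open>\<open>T\<close> is \<open>d * e * g\<close> times
    \<open>x / g + y / e + z / d\<close>. The equations give \<open>s1 = d * e / (2 * g)\<close> and
    its analogues, which make the quadratic part a multiple of the square of \<open>T\<close>, and
    \<open>l3 * d = g * l1 = e * l2\<close>, which makes the linear part a multiple of
    \<open>T\<close>.\<close>
  define T where "T x y z = d * e * x + d * g * y + e * g * z" for x y z
  have lin: "l3 / (e * g) * T x y z = l1 * x + l2 * y + l3 * z" for x y z
  proof -
    have "l3 * d = g * l1" "l3 * d = e * l2" using J1(1) J2(1) by (simp_all add: mult.commute)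
    then have "(l3 * d) * (e * x) = (g * l1) * (e * x)" "(l3 * d) * (g * y) = (e * l2) * (g * y)"
      by (simp_all only:)
    moreover have "l3 * T x y z = (l3 * d) * (e * x) + (l3 * d) * (g * y) + l3 * (e * g) * z"
      by (simp add: T_def algebra_simps)
    ultimately have "l3 * T x y z = (g * l1) * (e * x) + (e * l2) * (g * y) + l3 * (e * g) * z"
      by (simp only:)
    also have "\<dots> = (e * g) * (l1 * x + l2 * y + l3 * z)" by (simp add: algebra_simps)
    finally show ?thesis using nz by simp
  qed
  have quad: "1 / (2 * d * e * g) * (T x y z)\<^sup>2
      = s1 * x\<^sup>2 + s2 * y\<^sup>2 + s3 * z\<^sup>2 + d * x * y + e * x * z + g * y * z" for x y z
  proof -
    have eqs: "d * e = 2 * g * s1" "d * g = 2 * e * s2" "e * g = 2 * d * s3" using J1 J2 by simp_all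
    have "(T x y z)\<^sup>2 = (d * e) * (d * e) * x\<^sup>2 + (d * g) * (d * g) * y\<^sup>2 + (e * g) * (e * g) * z\<^sup>2
        + (2 * d * e * g) * (d * x * y + e * x * z + g * y * z)"
      unfolding T_def by (simp add: power2_eq_square algebra_simps)
    also have "\<dots> = (d * e) * (2 * g * s1) * x\<^sup>2 + (d * g) * (2 * e * s2) * y\<^sup>2 + (e * g) * (2 * d * s3) * z\<^sup>2
        + (2 * d * e * g) * (d * x * y + e * x * z + g * y * z)"
      by (simp only: eqs)
    also have "\<dots> = (2 * d * e * g) * (s1 * x\<^sup>2 + s2 * y\<^sup>2 + s3 * z\<^sup>2 + d * x * y + e * x * z + g * y * z)"
      by (simp add: algebra_simps)
    finally show ?thesis using nz by simp
  qed
  have poly2: "poly [:u0, u1, u2:] t = u0 + u1 * t + u2 * t\<^sup>2" for u0 u1 u2 t :: real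
    by (simp add: power2_eq_square algebra_simps)
  have poly1: "poly [:0, u:] t = u * t" for u t :: real by simp
  have "F x y z = c0 + l3 / (e * g) * T x y z + 1 / (2 * d * e * g) * (T x y z)\<^sup>2" for x y z
    unfolding F lin quad by simp
  then show ?thesis
    by - (rule exI[of _ "[:c0, l3 / (e * g), 1 / (2 * d * e * g):]"], rule exI[of _ "[:0, d * e:]"],
        rule exI[of _ "[:0, d * g:]"], rule exI[of _ "[:0, e * g:]"], simp only: poly2 poly1 T_def, simp)
qed

theorem theorem1p2:
  fixes f :: poly3 and A B C :: "real set"
  assumes quadratic: "total_degree3 f = 2"
    and dep: "depends_on_each_variable f"
    and not_special: "\<not> (\<exists>g h k l :: real poly. \<forall>x y z :: real.
          eval3 f x y z = poly g (poly h x + poly k y + poly l z))"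
    and compact: "compact A" "compact B" "compact C"
    and dim: "hausdorff_dim A + hausdorff_dim B + hausdorff_dim C > 2"
  shows "emeasure lebesgue (image3 f A B C) > 0"
proof -
  define c0 l1 l2 l3 s1 s2 s3 d e g where coeffs:
    "c0 = Poly_Mapping.lookup f (0, 0, 0)"
    "l1 = Poly_Mapping.lookup f (1, 0, 0)" "l2 = Poly_Mapping.lookup f (0, 1, 0)" "l3 = Poly_Mapping.lookup f (0, 0, 1)"
    "s1 = Poly_Mapping.lookup f (2, 0, 0)" "s2 = Poly_Mapping.lookup f (0, 2, 0)" "s3 = Poly_Mapping.lookup f (0, 0, 2)"
    "d = Poly_Mapping.lookup f (1, 1, 0)" "e = Poly_Mapping.lookup f (1, 0, 1)" "g = Poly_Mapping.lookup f (0, 1, 1)"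
  have F: "eval3 f x y z = c0 + l1 * x + l2 * y + l3 * z + s1 * x\<^sup>2 + s2 * y\<^sup>2 + s3 * z\<^sup>2
      + d * x * y + e * x * z + g * y * z" for x y z
    unfolding coeffs by (rule eval3_quadratic(1)[OF quadratic])
  note deg = eval3_quadratic(2)[OF quadratic]
  have dep': "(l1, s1, d, e) \<noteq> (0, 0, 0, 0)" "(l2, s2, d, g) \<noteq> (0, 0, 0, 0)" "(l3, s3, e, g) \<noteq> (0, 0, 0, 0)"
  proof -
    obtain i j k where 1: "(i, j, k) \<in> Poly_Mapping.keys f" "0 < i"
      using dep by (auto simp: depends_on_each_variable_def)
    have "i = 1 \<and> j = 0 \<and> k = 0 \<or> i = 2 \<and> j = 0 \<and> k = 0 \<or> i = 1 \<and> j = 1 \<and> k = 0 \<or> i = 1 \<and> j = 0 \<and> k = 1"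
      using deg[OF 1(1)] 1(2) by presburger
    then show "(l1, s1, d, e) \<noteq> (0, 0, 0, 0)" using 1(1) unfolding coeffs in_keys_iff by auto
    obtain i j k where 2: "(i, j, k) \<in> Poly_Mapping.keys f" "0 < j"
      using dep by (auto simp: depends_on_each_variable_def)
    have "i = 0 \<and> j = 1 \<and> k = 0 \<or> i = 0 \<and> j = 2 \<and> k = 0 \<or> i = 1 \<and> j = 1 \<and> k = 0 \<or> i = 0 \<and> j = 1 \<and> k = 1"
      using deg[OF 2(1)] 2(2) by presburger
    then show "(l2, s2, d, g) \<noteq> (0, 0, 0, 0)" using 2(1) unfolding coeffs in_keys_iff by auto
    obtain i j k where 3: "(i, j, k) \<in> Poly_Mapping.keys f" "0 < k"
      using dep by (auto simp: depends_on_each_variable_def)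
    have "i = 0 \<and> j = 0 \<and> k = 1 \<or> i = 0 \<and> j = 0 \<and> k = 2 \<or> i = 1 \<and> j = 0 \<and> k = 1 \<or> i = 0 \<and> j = 1 \<and> k = 1"
      using deg[OF 3(1)] 3(2) by presburger
    then show "(l3, s3, e, g) \<noteq> (0, 0, 0, 0)" using 3(1) unfolding coeffs in_keys_iff by auto
  qed
  \<comment> \<open>The Jacobian coefficients with \<open>x\<close>, \<open>y\<close>,
    \<open>z\<close> singled out in turn: the constant term, then the coefficients of the two
    remaining variables in alphabetical order.\<close>
  let ?J1 = "(d * l3 - e * l2, d * g - 2 * e * s2, 2 * d * s3 - e * g)"
  let ?J2 = "(d * l3 - g * l1, d * e - 2 * g * s1, 2 * d * s3 - g * e)"
  let ?J3 = "(e * l2 - g * l1, e * d - 2 * g * s1, 2 * e * s2 - g * d)"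
  have "?J1 \<noteq> (0, 0, 0) \<or> ?J2 \<noteq> (0, 0, 0) \<or> ?J3 \<noteq> (0, 0, 0)"
  proof (rule ccontr)
    assume "\<not> ?thesis"
    then have "\<exists>G h k l :: real poly. \<forall>x y z. eval3 f x y z = poly G (poly h x + poly k y + poly l z)"
      by (intro quadratic_special_form[where F = "eval3 f", OF F _ _ _ _ _ _ _ _ _ dep']) auto
    with not_special show False by blast
  qed
  then show ?thesis
  proof (elim disjE)
    assume J: "?J1 \<noteq> (0, 0, 0)"
    have "eval3 f x y z = c0 + l1 * x + s1 * x\<^sup>2
        + (x * (d * y + e * z) + (s2 * y\<^sup>2 + g * y * z + s3 * z\<^sup>2 + l2 * y + l3 * z))" for x y z
      unfolding F by (simp add: algebra_simps)
    from quadratic_image_pos[where F = "eval3 f", OF this compact dim J] show ?thesis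
      by (simp add: image3_def)
  next
    assume J: "?J2 \<noteq> (0, 0, 0)"
    have "eval3 f x y z = c0 + l2 * y + s2 * y\<^sup>2
        + (y * (d * x + g * z) + (s1 * x\<^sup>2 + e * x * z + s3 * z\<^sup>2 + l1 * x + l3 * z))" for x y z
      unfolding F by (simp add: algebra_simps)
    from quadratic_image_pos[where F = "\<lambda>y x z. eval3 f x y z", OF this compact(2,1,3) _ J] dim
    have "0 < emeasure lebesgue {eval3 f x y z | y x z. y \<in> B \<and> x \<in> A \<and> z \<in> C}"
      by (simp add: add_ac)
    also have "{eval3 f x y z | y x z. y \<in> B \<and> x \<in> A \<and> z \<in> C} = image3 f A B C"
      unfolding image3_def by blast
    finally show ?thesis .
  next
    assume J: "?J3 \<noteq> (0, 0, 0)"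
    have "eval3 f x y z = c0 + l3 * z + s3 * z\<^sup>2
        + (z * (e * x + g * y) + (s1 * x\<^sup>2 + d * x * y + s2 * y\<^sup>2 + l1 * x + l2 * y))" for x y z
      unfolding F by (simp add: algebra_simps)
    from quadratic_image_pos[where F = "\<lambda>z x y. eval3 f x y z", OF this compact(3,1,2) _ J] dim
    have "0 < emeasure lebesgue {eval3 f x y z | z x y. z \<in> C \<and> x \<in> A \<and> y \<in> B}"
      by (simp add: add_ac)
    also have "{eval3 f x y z | z x y. z \<in> C \<and> x \<in> A \<and> y \<in> B} = image3 f A B C"
      unfolding image3_def by blast
    finally show ?thesis .
  qed
qed

end
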